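(* Let $n\ge 1$ and let $F_1,\ldots,F_{2n}$ be an ordering of the facets of the (combinatorial) $n$-cube. Then $F_1,\ldots,F_{2n}$ is a shelling of the $n$-cube if and only if it is a line shelling, i.e. if and only if there is a realization of the $n$-cube for which this ordering of the facets is the line shelling associated to some line. In particular, all shellings of cubes are line shellings.
   Context: A realization of the $n$-cube is a convex polytope $Q\subset\mathbb{R}^n$ together with an isomorphism of its face lattice with the face lattice of the cube $[0,1]^n$; facets of $Q$ are thereby identified with facets of the $n$-cube. Shelling of a polytope (standard recursive definition): for a polytope of dimension $1$, any ordering of its two facets (its endpoints) is a shelling. For a polytope $P$ of dimension $n\ge 2$, an ordering $F_1,\ldots,F_s$ of all its facets is a shelling if for every $1<j\le s$, the set $F_j\cap(F_1\cup\cdots\cup F_{j-1})$ is nonempty and equals $G_1\cup\cdots\cup G_r$ for some shelling $G_1,\ldots,G_r,\ldots,G_t$ of the facets of $F_j$ with $1\le r\le t$ (and the facets of $F_1$ also admit a shelling). Line shelling: let $Q\subset\mathbb{R}^n$ be a realization and let $\ell$ be a directed line through an interior point of $Q$ that is in general position, meaning that it meets the affine hulls of the facets of $Q$ in pairwise distinct points (and is parallel to none of them). Travel along $\ell$ starting from the interior point in the given direction out to infinity, then return from infinity on the opposite end of $\ell$ back to the interior point. The line shelling of $Q$ associated to $\ell$ is the ordering of the facets of $Q$ according to the order in which their affine hulls are crossed. *)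

theory Defs
  imports "HOL-Analysis.Analysis"
begin

definition facets :: "'a::euclidean_space set \<Rightarrow> 'a set set" where
  "facets P = {F. F facet_of P}"

definition facet_ordering :: "'a::euclidean_space set \<Rightarrow> 'a set list \<Rightarrow> bool" where
  "facet_ordering P Fs \<longleftrightarrow> distinct Fs \<and> set Fs = facets P"

(* Lists are indexed from 0, so Fs ! 0 is the first facet, and
   set (take j Fs) is the set of the facets preceding Fs ! j. *)
inductive shelling :: "'a::euclidean_space set \<Rightarrow> 'a set list \<Rightarrow> bool" where
  dim_one: "shelling P Fs"
    if "polytope P" "aff_dim P = 1" "facet_ordering P Fs"
| dim_ge_two: "shelling P Fs"
    if "polytope P" "aff_dim P \<ge> 2" "facet_ordering P Fs"
       "\<exists>Gs. shelling (Fs ! 0) Gs"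
       "\<forall>j. 0 < j \<and> j < length Fs \<longrightarrow>
          Fs ! j \<inter> \<Union> (set (take j Fs)) \<noteq> {} \<and>
          (\<exists>Gs r. shelling (Fs ! j) Gs \<and> 1 \<le> r \<and> r \<le> length Gs \<and>
             Fs ! j \<inter> \<Union> (set (take j Fs)) = \<Union> (set (take r Gs)))"

definition unit_cube :: "(real ^ 'n) set" where
  "unit_cube = cbox 0 1"

definition face_lattice :: "'a::euclidean_space set \<Rightarrow> 'a set set" where
  "face_lattice P = {F. F face_of P}"

definition face_lattice_iso ::
  "'a::euclidean_space set \<Rightarrow> 'b::euclidean_space set \<Rightarrow> ('a set \<Rightarrow> 'b set) \<Rightarrow> bool" where
  "face_lattice_iso P Q \<phi> \<longleftrightarrow>
     bij_betw \<phi> (face_lattice P) (face_lattice Q) \<and>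
     (\<forall>F\<in>face_lattice P. \<forall>G\<in>face_lattice P. F \<subseteq> G \<longleftrightarrow> \<phi> F \<subseteq> \<phi> G)"

definition cube_realization ::
  "(real ^ 'n) set \<Rightarrow> ((real ^ 'n) set \<Rightarrow> (real ^ 'n) set) \<Rightarrow> bool" where
  "cube_realization Q \<phi> \<longleftrightarrow> polytope Q \<and> face_lattice_iso unit_cube Q \<phi>"

(* The line through p directed by v is parametrized as t \<mapsto> p + t v. *)
definition crossing_time :: "'a::euclidean_space \<Rightarrow> 'a \<Rightarrow> 'a set \<Rightarrow> real" where
  "crossing_time p v F = (THE t. p + t *\<^sub>R v \<in> affine hull F)"

(* For p off the hyperplane spanned by a facet, unique existence of t says
   exactly that the line is not parallel to that hyperplane; it also makes
   crossing_time well defined and forces v to be nonzero. *)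
definition general_position :: "'a::euclidean_space set \<Rightarrow> 'a \<Rightarrow> 'a \<Rightarrow> bool" where
  "general_position Q p v \<longleftrightarrow>
     (\<forall>F\<in>facets Q. \<exists>!t. p + t *\<^sub>R v \<in> affine hull F) \<and>
     inj_on (crossing_time p v) (facets Q)"

(* Travelling from parameter 0 up to infinity, and then from minus infinity
   back up to 0. *)
definition crossed_before :: "real \<Rightarrow> real \<Rightarrow> bool" where
  "crossed_before s t \<longleftrightarrow> (0 < s \<and> s < t) \<or> (0 < s \<and> t < 0) \<or> (s < t \<and> t < 0)"

definition line_shelling ::
  "'a::euclidean_space set \<Rightarrow> 'a \<Rightarrow> 'a \<Rightarrow> 'a set list \<Rightarrow> bool" where
  "line_shelling Q p v Fs \<longleftrightarrow>
     p \<in> interior Q \<and> general_position Q p v \<and> facet_ordering Q Fs \<and>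
     sorted_wrt (\<lambda>F G. crossed_before (crossing_time p v F) (crossing_time p v G)) Fs"

end

theory Submission
  imports Defs
begin

text \<open>Both kinds of orderings turn out to be described by the same condition, \<open>linked\<close>, on the positions
  of opposite facets: each pair of opposite facets spans an interval of positions, and each cut
  between consecutive positions has to be bridged by such an interval. Equivalently, no proper
  nonempty initial segment of the ordering is a union of opposite pairs.

  For shellings (\<open>cubical_shelling_iff_linked\<close>) this follows by induction on the dimension. Facet \<open>j\<close>
  is again a cube, and it meets the earlier facets in those of its facets that they cut out. By
  induction these form an initial segment of a shelling exactly if they are all of its facets or
  contain a facet without its opposite.

  For a line shelling, parametrize the line projectively by the inverse of its parameter; the facets
  are then crossed in decreasing order. An initial segment that is a union of opposite pairs yields a
  point (before, at or after infinity) beyond exactly both facets of each of these pairs. In the cone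
  over the realization, such a vector can be pushed, without changing sides of those pairs, onto a
  facet of each other pair. The negative of the result lies in the span of a face, on the inner side
  of all of the pairs used for the initial segment; it must lie in that face, yet fails to be
  strictly on the inner side of some opposite facet (\<open>no_unbridged_vector\<close>, \<open>line_shelling_linked\<close>).

  Conversely, a linked order is realized through the polar polytope (\<open>linked_line_shelling\<close>). There a
  line shelling is an ordering of the vertices of a cross-polytope by height. A cross-polytope can be
  built by successive suspensions, where the segment joining the two new vertices meets the interior
  of the polytope built before. Prescribed heights can be achieved if the interval between the two
  new heights overlaps the range of the earlier ones, which is what linkedness provides when the
  pairs are taken in the order of their first occurrence.

  All of this concerns the labels of the facets only. The notion \<open>cubical\<close> of a polytope with the facet
  structure of a cube is equivalent to having the face lattice of the cube
  (\<open>cubical_face_lattice_iso\<close>, \<open>face_lattice_iso_cubical\<close>), but speaks of facets and their common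
  points alone.\<close>



section \<open>Facets of polytopes\<close>

lemma facet_maximal:
  assumes "polytope P" "F facet_of P" "G face_of P" "F \<subseteq> G" "G \<noteq> P"
  shows "F = G"
proof (rule ccontr)
  assume "F \<noteq> G"
  moreover have "F face_of G"
    using assms by (meson face_of_subset face_of_imp_subset facet_of_imp_face_of)
  moreover have "convex P" "convex G"
    using assms polytope_imp_convex face_of_imp_convex by blast+
  ultimately have "aff_dim F < aff_dim G" "aff_dim G < aff_dim P"
    using assms face_of_aff_dim_lt by blast+
  then show False
    using assms(2) by (simp add: facet_of_def)
qed

lemma facet_of_iff_maximal:
  assumes "polytope P"
  shows "F facet_of P \<longleftrightarrow> F face_of P \<and> F \<noteq> {} \<and> F \<noteq> P \<and>
    (\<forall>G. G face_of P \<and> F \<subseteq> G \<longrightarrow> G = F \<or> G = P)" (is "_ \<longleftrightarrow> ?R")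
proof
  assume F: "F facet_of P"
  moreover have "F \<noteq> P"
    using F by (auto simp: facet_of_def)
  ultimately show ?R
    using facet_maximal[OF assms] by (auto simp: facet_of_def)
next
  assume R: ?R
  then obtain G where "G facet_of P" "F \<subseteq> G"
    using face_of_polyhedron_subset_facet[OF polytope_imp_polyhedron[OF assms]] by blast
  moreover have "G \<noteq> P"
    using \<open>G facet_of P\<close> by (auto simp: facet_of_def)
  ultimately show "F facet_of P"
    using R facet_of_imp_face_of by blast
qed

text \<open>A point in the relative interior of a facet lies on no other facet, so a set of facets can
  be recovered from its union.\<close>

lemma facets_Union_subset:
  assumes "polytope P" "A \<subseteq> facets P" "B \<subseteq> facets P" "\<Union>A \<subseteq> \<Union>B"
  shows "A \<subseteq> B"
proof
  fix F assume "F \<in> A"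
  then have F: "F facet_of P"
    using assms(2) by (auto simp: facets_def)
  then have "F \<noteq> {}" "convex F"
    by (auto simp: facet_of_def face_of_imp_convex)
  then obtain x where x: "x \<in> rel_interior F"
    using rel_interior_eq_empty by blast
  then have "x \<in> \<Union>B"
    using \<open>F \<in> A\<close> assms(4) rel_interior_subset by blast
  then obtain G where G: "G \<in> B" "x \<in> G"
    by blast
  then have G': "G facet_of P"
    using assms(3) by (auto simp: facets_def)
  then have "F \<subseteq> G"
    using subset_of_face_of[of G P F] x G F facet_of_imp_subset facet_of_imp_face_of by blast
  moreover have "G \<noteq> P"
    using G' by (auto simp: facet_of_def)
  ultimately have "F = G"
    using facet_maximal[OF assms(1) F] G' facet_of_imp_face_of by blast
  with G show "F \<in> B"
    by simp
qed

lemma facets_Union_eq_iff: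
  assumes "polytope P" "A \<subseteq> facets P" "B \<subseteq> facets P"
  shows "\<Union>A = \<Union>B \<longleftrightarrow> A = B"
  using facets_Union_subset[OF assms] facets_Union_subset[OF assms(1,3,2)] by blast


section \<open>Polytopes with the facet structure of a cube\<close>

text \<open>The facets are labelled by pairs \<open>(i, e)\<close>, where \<open>i \<in> K\<close> is a coordinate direction and \<open>e\<close>
  chooses one of two opposite facets. Disjointness of opposite facets together with a common point
  for each choice of one facet from each pair already determines which facets meet, hence the whole
  face lattice; this form can be verified directly for a polytope given by inequalities, and it is
  inherited by facets.\<close>

definition cubical :: "'i set \<Rightarrow> 'a::euclidean_space set \<Rightarrow> ('i \<times> bool \<Rightarrow> 'a set) \<Rightarrow> bool" where
  "cubical K P F \<longleftrightarrow> polytope P \<and> facets P = F ` (K \<times> UNIV) \<and>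
     (\<forall>i\<in>K. F (i, True) \<inter> F (i, False) = {}) \<and>
     (\<forall>\<sigma>. P \<inter> (\<Inter>i\<in>K. F (i, \<sigma> i)) \<noteq> {})"

lemma cubical_polytope: "cubical K P F \<Longrightarrow> polytope P"
  and cubical_facets: "cubical K P F \<Longrightarrow> facets P = F ` (K \<times> UNIV)"
  by (simp_all add: cubical_def)

lemma cubical_disjoint:
  assumes "cubical K P F" "i \<in> K"
  shows "F (i, e) \<inter> F (i, \<not> e) = {}"
  using assms by (cases e) (auto simp: cubical_def)

lemma cubical_vertex:
  assumes "cubical K P F"
  shows "\<exists>v\<in>P. \<forall>i\<in>K. \<forall>e. v \<in> F (i, e) \<longleftrightarrow> e = \<sigma> i"
proof -
  have "P \<inter> (\<Inter>i\<in>K. F (i, \<sigma> i)) \<noteq> {}"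
    using assms by (simp add: cubical_def)
  then obtain v where v: "v \<in> P" "\<And>i. i \<in> K \<Longrightarrow> v \<in> F (i, \<sigma> i)"
    by blast
  have "v \<in> F (i, e) \<longleftrightarrow> e = \<sigma> i" if "i \<in> K" for i e
    using v(2)[OF that] cubical_disjoint[OF assms that, of e] by (cases "e = \<sigma> i") auto
  with v(1) show ?thesis
    by blast
qed

lemma cubical_facet:
  "cubical K P F \<Longrightarrow> i \<in> K \<Longrightarrow> F (i, e) facet_of P"
  unfolding cubical_def facets_def by blast

lemma cubical_facetE:
  assumes "cubical K P F" "G facet_of P"
  obtains i e where "i \<in> K" "G = F (i, e)"
proof -
  have "G \<in> F ` (K \<times> UNIV)"
    using assms by (simp add: cubical_def facets_def set_eq_iff)
  then show ?thesis
    using that by auto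
qed

text \<open>An intersection of facets, no two of them opposite, lies in no further facet: some vertex of
  it avoids the given one.\<close>

lemma cubical_Inter_subset:
  assumes C: "cubical K P F" and A: "A \<subseteq> K \<times> UNIV"
    and cons: "\<And>i. \<not> ((i, True) \<in> A \<and> (i, False) \<in> A)"
    and x: "x \<in> K \<times> UNIV" and sub: "P \<inter> \<Inter> (F ` A) \<subseteq> F x"
  shows "x \<in> A"
proof (rule ccontr)
  assume "x \<notin> A"
  obtain i e where ie: "x = (i, e)"
    by (cases x)
  define \<sigma> where "\<sigma> k = (if k = i then \<not> e else (k, True) \<in> A)" for k
  obtain v where v: "v \<in> P" "\<And>k d. k \<in> K \<Longrightarrow> v \<in> F (k, d) \<longleftrightarrow> d = \<sigma> k"
    using cubical_vertex[OF C, of \<sigma>] by blast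
  have "v \<in> F y" if "y \<in> A" for y
  proof -
    obtain k d where y: "y = (k, d)"
      by (cases y)
    have "k \<in> K" "(k, d) \<in> A"
      using A that y by auto
    moreover have "d = \<sigma> k"
      using \<open>(k, d) \<in> A\<close> cons[of k] \<open>x \<notin> A\<close> ie by (cases d; cases e) (auto simp: \<sigma>_def)
    ultimately show ?thesis
      using v(2)[of k d] y by simp
  qed
  then have "v \<in> P \<inter> \<Inter> (F ` A)"
    using v(1) by simp
  then have "v \<in> F (i, e)"
    using subsetD[OF sub] by (simp only: ie)
  moreover have "i \<in> K"
    using x ie by simp
  ultimately have "e \<longleftrightarrow> \<sigma> i"
    using v(2)[of i e] by simp
  then show False
    by (cases e) (simp_all add: \<sigma>_def)
qed

lemma cubical_subset_iff:
  assumes "cubical K P F" "x \<in> K \<times> UNIV" "y \<in> K \<times> UNIV"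
  shows "F x \<subseteq> F y \<longleftrightarrow> x = y"
proof
  assume "F x \<subseteq> F y"
  then have "P \<inter> \<Inter> (F ` {x}) \<subseteq> F y"
    by blast
  moreover have "{x} \<subseteq> K \<times> UNIV"
    using assms(2) by blast
  moreover have "\<not> ((i, True) \<in> {x} \<and> (i, False) \<in> {x})" for i
    by blast
  ultimately have "y \<in> {x}"
    using cubical_Inter_subset[OF assms(1) _ _ assms(3)] by blast
  then show "x = y"
    by simp
qed simp

lemma cubical_inj_on:
  assumes "cubical K P F"
  shows "inj_on F (K \<times> UNIV)"
proof (rule inj_onI)
  fix x y assume xy: "x \<in> K \<times> UNIV" "y \<in> K \<times> UNIV" "F x = F y"
  show "x = y"
    by (rule iffD1[OF cubical_subset_iff[OF assms xy(1,2)]]) (simp add: xy(3))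
qed

text \<open>A facet of \<open>F (i, e)\<close> is an intersection of facets of \<open>P\<close>, so it is contained in, hence equal to,
  some \<open>F (i, e) \<inter> F x\<close>. Conversely each such intersection is contained in a facet of \<open>F (i, e)\<close>,
  which has the same form; comparing vertices shows that it has the same label.\<close>

lemma cubical_facet_cubical:
  assumes C: "cubical K P F" and i: "i \<in> K"
  shows "cubical (K - {i}) (F (i, e)) (\<lambda>x. F (i, e) \<inter> F x)"
proof -
  note P = cubical_polytope[OF C]
  let ?G = "F (i, e)"
  have G: "?G facet_of P"
    using cubical_facet[OF C i] .
  then have Gf: "?G face_of P" and GP: "?G \<subseteq> P"
    by (auto simp: facet_of_imp_face_of facet_of_imp_subset)
  have pG: "polytope ?G"
    using face_of_polytope_polytope[OF P Gf] .
  have ridge_face: "?G \<inter> F (k, d) face_of ?G" if "k \<in> K" for k d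
  proof -
    have "?G \<inter> F (k, d) face_of P"
      using Gf cubical_facet[OF C that] by (simp add: face_of_Int facet_of_imp_face_of)
    then show ?thesis
      by (rule face_of_subset) (use GP in auto)
  qed
  have proper: "?G \<inter> F (k, d) \<noteq> ?G" if "k \<in> K - {i}" for k d
    using cubical_subset_iff[OF C, of "(i,e)" "(k,d)"] i that by blast
  have nonempty: "?G \<inter> F (k, d) \<noteq> {}" if "k \<in> K - {i}" for k d
  proof -
    obtain v where "v \<in> P" "\<And>l c. l \<in> K \<Longrightarrow> v \<in> F (l, c) \<longleftrightarrow> c = (if l = i then e else d)"
      using cubical_vertex[OF C, of "\<lambda>l. if l = i then e else d"] by blast
    then have "v \<in> ?G" "v \<in> F (k, d)"
      using i that by simp_all
    then show ?thesis
      by blast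
  qed
  have 1: "R \<in> (\<lambda>x. ?G \<inter> F x) ` ((K - {i}) \<times> UNIV)" if R: "R facet_of ?G" for R
  proof -
    have Rf: "R face_of P"
      using face_of_trans[OF facet_of_imp_face_of[OF R] Gf] .
    have Rn: "R \<noteq> {}" "R \<noteq> ?G" "R \<subseteq> ?G"
      using R by (auto simp: facet_of_def dest: face_of_imp_subset)
    have RP: "R \<noteq> P"
      using Rn GP by blast
    have "R = \<Inter> {H. H facet_of P \<and> R \<subseteq> H}"
      using face_of_polyhedron[OF polytope_imp_polyhedron[OF P] Rf Rn(1) RP] .
    then obtain H where H: "H facet_of P" "R \<subseteq> H" "H \<noteq> ?G"
      using Rn by blast
    then obtain k d where k: "k \<in> K" "H = F (k, d)"
      using cubical_facetE[OF C] by metis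
    have "k \<noteq> i"
    proof
      assume "k = i"
      then have "d = (\<not> e)"
        using H(3) k by (cases d; cases e) simp_all
      then show False
        using cubical_disjoint[OF C i, of e] H(2) Rn k \<open>k = i\<close> by blast
    qed
    then have "R = ?G \<inter> F (k, d)"
      using facet_maximal[OF pG R ridge_face[OF k(1), of d]] proper[of k d] Rn H k by blast
    then show ?thesis
      using k \<open>k \<noteq> i\<close> by blast
  qed
  have 2: "?G \<inter> F (k, d) facet_of ?G" if k: "k \<in> K - {i}" for k d
  proof -
    obtain R where R: "R facet_of ?G" "?G \<inter> F (k, d) \<subseteq> R"
      using face_of_polyhedron_subset_facet[OF polytope_imp_polyhedron[OF pG]]
        ridge_face nonempty proper k by (metis DiffE)
    obtain l c where l: "l \<in> K - {i}" "R = ?G \<inter> F (l, c)"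
      using 1[OF R(1)] by auto
    have "(l, c) \<in> {(i, e), (k, d)}"
      by (rule cubical_Inter_subset[OF C]) (use l k i R in auto)
    then have "R = ?G \<inter> F (k, d)"
      using l by auto
    with R show ?thesis
      by simp
  qed
  have "facets ?G = (\<lambda>x. ?G \<inter> F x) ` ((K - {i}) \<times> UNIV)"
    using 1 2 by (auto simp: facets_def)
  moreover have "?G \<inter> (\<Inter>k\<in>K - {i}. ?G \<inter> F (k, \<sigma> k)) \<noteq> {}" for \<sigma>
  proof -
    obtain v where "v \<in> P" "\<And>l c. l \<in> K \<Longrightarrow> v \<in> F (l, c) \<longleftrightarrow> c = (\<sigma>(i := e)) l"
      using cubical_vertex[OF C, of "\<sigma>(i := e)"] by blast
    then have "v \<in> ?G \<inter> (\<Inter>k\<in>K - {i}. ?G \<inter> F (k, \<sigma> k))"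
      using i by auto
    then show ?thesis
      by blast
  qed
  moreover have "?G \<inter> F (k, True) \<inter> (?G \<inter> F (k, False)) = {}" if "k \<in> K - {i}" for k
    using cubical_disjoint[OF C, of k True] that by auto
  ultimately show ?thesis
    using pG unfolding cubical_def by blast
qed

lemma cubical_aff_dim:
  assumes "finite K" "cubical K P F"
  shows "aff_dim P = int (card K)"
  using assms
proof (induction "card K" arbitrary: K P F)
  case 0
  then have K: "K = {}"
    by simp
  then have "P \<noteq> {}" "\<And>G. \<not> G facet_of P"
    using 0 by (auto simp: cubical_def facets_def)
  then have "aff_dim P \<ge> 0" "\<not> aff_dim P > 0"
    using polytope_facet_exists[OF cubical_polytope[OF 0(3)]]
    by (simp_all add: aff_dim_negative_iff flip: not_less) blast
  then show ?case
    using K by simp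
next
  case (Suc n)
  then obtain i where i: "i \<in> K"
    by (metis card.empty all_not_in_conv nat.distinct(1))
  have "aff_dim (F (i, True)) = int (card (K - {i}))"
    using Suc.hyps(1)[OF _ _ cubical_facet_cubical[OF Suc.prems(2) i, of True]] Suc i by auto
  then show ?case
    using cubical_facet[OF Suc.prems(2) i, of True] i Suc.hyps(2) by (auto simp: facet_of_def)
qed


section \<open>Cubical polytopes and the face lattice\<close>

text \<open>Two cubical polytopes have isomorphic face lattices because a face is the intersection of the
  facets containing it, and the sets of labels that arise in this way depend only on \<open>K\<close>: they are
  those without an opposite pair, and the set of all labels for the empty face.\<close>

definition facet_labels :: "'i set \<Rightarrow> ('i \<times> bool \<Rightarrow> 'a set) \<Rightarrow> 'a set \<Rightarrow> ('i \<times> bool) set" where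
  "facet_labels K F G = {x \<in> K \<times> UNIV. G \<subseteq> F x}"

definition labelled_face :: "'a set \<Rightarrow> ('i \<times> bool \<Rightarrow> 'a set) \<Rightarrow> ('i \<times> bool) set \<Rightarrow> 'a set" where
  "labelled_face P F A = P \<inter> \<Inter> (F ` A)"

lemma labelled_face_facet_labels:
  assumes C: "cubical K P F" and K: "K \<noteq> {}" and G: "G face_of P"
  shows "labelled_face P F (facet_labels K F G) = G"
proof -
  consider "G = {}" | "G = P" | "G \<noteq> {}" "G \<noteq> P"
    by blast
  then show ?thesis
  proof cases
    case 1
    obtain i where i: "i \<in> K"
      using K by blast
    then have "labelled_face P F (facet_labels K F G) \<subseteq> F (i, True) \<inter> F (i, False)"
      using 1 by (auto simp: labelled_face_def facet_labels_def)
    then show ?thesis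
      using cubical_disjoint[OF C i, of True] 1 by auto
  next
    case 2
    have "\<not> P \<subseteq> F x" if "x \<in> K \<times> UNIV" for x
    proof -
      have "F x facet_of P"
        using that cubical_facet[OF C] by auto
      then have "F x \<noteq> P" "F x \<subseteq> P"
        by (auto simp: facet_of_def dest: face_of_imp_subset)
      then show ?thesis
        by blast
    qed
    then have "facet_labels K F G = {}"
      using 2 by (auto simp: facet_labels_def)
    then show ?thesis
      using 2 by (simp add: labelled_face_def)
  next
    case 3
    have "G = \<Inter> {H. H facet_of P \<and> G \<subseteq> H}"
      using face_of_polyhedron[OF polytope_imp_polyhedron[OF cubical_polytope[OF C]] G 3] .
    moreover have "{H \<in> {H. H facet_of P}. G \<subseteq> H} = F ` facet_labels K F G"
      using cubical_facets[OF C] unfolding facets_def facet_labels_def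
      by (simp only: Compr_image_eq)
    ultimately have "G = \<Inter> (F ` facet_labels K F G)"
      by simp
    then show ?thesis
      using face_of_imp_subset[OF G] unfolding labelled_face_def by blast
  qed
qed

lemma labelled_face_face:
  assumes C: "cubical K P F" and A: "A \<subseteq> K \<times> UNIV"
  shows "labelled_face P F A face_of P"
proof -
  have "F x face_of P" if "x \<in> A" for x
    using that A cubical_facet[OF C] by (cases x) (auto simp: facet_of_imp_face_of)
  moreover have "P face_of P"
    using cubical_polytope[OF C] by (simp add: face_of_refl polytope_imp_convex)
  ultimately have "\<Inter> (insert P (F ` A)) face_of P"
    by (intro face_of_Inter) auto
  then show ?thesis
    by (simp add: labelled_face_def)
qed

lemma facet_labels_labelled_face:
  assumes C: "cubical K P F" and A: "A \<subseteq> K \<times> UNIV"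
  shows "facet_labels K F (labelled_face P F A) =
    (if \<exists>i. (i, True) \<in> A \<and> (i, False) \<in> A then K \<times> UNIV else A)"
proof (cases "\<exists>i. (i, True) \<in> A \<and> (i, False) \<in> A")
  case True
  then obtain i where i: "(i, True) \<in> A" "(i, False) \<in> A"
    by blast
  then have "labelled_face P F A \<subseteq> F (i, True) \<inter> F (i, False)"
    by (auto simp: labelled_face_def)
  then have "labelled_face P F A = {}"
    using cubical_disjoint[OF C, of i True] i A by auto
  with True show ?thesis
    by (auto simp: facet_labels_def)
next
  case False
  then have "facet_labels K F (labelled_face P F A) \<subseteq> A"
    using cubical_Inter_subset[OF C A, folded labelled_face_def]
    unfolding facet_labels_def by blast
  moreover have "A \<subseteq> facet_labels K F (labelled_face P F A)"
    using A by (auto simp: facet_labels_def labelled_face_def)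
  ultimately show ?thesis
    using False by auto
qed

lemma cubical_face_lattice_iso:
  assumes P: "cubical K P F" and Q: "cubical K Q H" and K: "K \<noteq> {}"
  obtains \<phi> where "face_lattice_iso P Q \<phi>" "\<And>x. x \<in> K \<times> UNIV \<Longrightarrow> \<phi> (F x) = H x"
proof
  define \<phi> where "\<phi> G = labelled_face Q H (facet_labels K F G)" for G
  define \<psi> where "\<psi> G = labelled_face P F (facet_labels K H G)" for G
  have sub: "facet_labels K F G \<subseteq> K \<times> UNIV" "facet_labels K H G' \<subseteq> K \<times> UNIV" for G G'
    by (auto simp: facet_labels_def)
  have labels_\<phi>: "facet_labels K H (\<phi> G) = facet_labels K F G" if "G face_of P" for G
  proof -
    let ?A = "facet_labels K F G"
    have "facet_labels K H (\<phi> G) =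
        (if \<exists>i. (i, True) \<in> ?A \<and> (i, False) \<in> ?A then K \<times> UNIV else ?A)"
      unfolding \<phi>_def by (rule facet_labels_labelled_face[OF Q sub(1)])
    also have "\<dots> = facet_labels K F (labelled_face P F ?A)"
      by (rule facet_labels_labelled_face[OF P sub(1), symmetric])
    also have "\<dots> = ?A"
      by (simp only: labelled_face_facet_labels[OF P K that])
    finally show ?thesis .
  qed
  have labels_\<psi>: "facet_labels K F (\<psi> G) = facet_labels K H G" if "G face_of Q" for G
  proof -
    let ?A = "facet_labels K H G"
    have "facet_labels K F (\<psi> G) =
        (if \<exists>i. (i, True) \<in> ?A \<and> (i, False) \<in> ?A then K \<times> UNIV else ?A)"
      unfolding \<psi>_def by (rule facet_labels_labelled_face[OF P sub(2)])
    also have "\<dots> = facet_labels K H (labelled_face Q H ?A)"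
      by (rule facet_labels_labelled_face[OF Q sub(2), symmetric])
    also have "\<dots> = ?A"
      by (simp only: labelled_face_facet_labels[OF Q K that])
    finally show ?thesis .
  qed
  have faces: "\<phi> G face_of Q" "\<psi> G' face_of P" for G G'
    unfolding \<phi>_def \<psi>_def using labelled_face_face[OF Q sub(1)] labelled_face_face[OF P sub(2)] .
  have "bij_betw \<phi> (face_lattice P) (face_lattice Q)"
  proof (rule bij_betwI[where g = \<psi>])
    show "\<psi> (\<phi> G) = G" if "G \<in> face_lattice P" for G
      using that labels_\<phi>[of G] labelled_face_facet_labels[OF P K, of G]
      by (simp only: \<psi>_def face_lattice_def mem_Collect_eq)
    show "\<phi> (\<psi> G) = G" if "G \<in> face_lattice Q" for G
      using that labels_\<psi>[of G] labelled_face_facet_labels[OF Q K, of G]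
      by (simp only: \<phi>_def face_lattice_def mem_Collect_eq)
  qed (use faces in \<open>auto simp: face_lattice_def\<close>)
  moreover have "G \<subseteq> G' \<longleftrightarrow> \<phi> G \<subseteq> \<phi> G'" if "G face_of P" "G' face_of P" for G G'
  proof -
    have 1: "G \<subseteq> G' \<longleftrightarrow> facet_labels K F G' \<subseteq> facet_labels K F G"
    proof
      assume "facet_labels K F G' \<subseteq> facet_labels K F G"
      then have "labelled_face P F (facet_labels K F G) \<subseteq> labelled_face P F (facet_labels K F G')"
        by (auto simp: labelled_face_def)
      then show "G \<subseteq> G'"
        using that labelled_face_facet_labels[OF P K] by simp
    qed (auto simp: facet_labels_def)
    have 2: "\<phi> G \<subseteq> \<phi> G' \<longleftrightarrow> facet_labels K F G' \<subseteq> facet_labels K F G"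
    proof
      assume "\<phi> G \<subseteq> \<phi> G'"
      then have "facet_labels K H (\<phi> G') \<subseteq> facet_labels K H (\<phi> G)"
        by (auto simp: facet_labels_def)
      then show "facet_labels K F G' \<subseteq> facet_labels K F G"
        using that labels_\<phi> by simp
    qed (auto simp: \<phi>_def labelled_face_def)
    show ?thesis
      using 1 2 by simp
  qed
  ultimately show "face_lattice_iso P Q \<phi>"
    by (auto simp: face_lattice_iso_def face_lattice_def)
  show "\<phi> (F x) = H x" if x: "x \<in> K \<times> UNIV" for x
  proof -
    have "facet_labels K F (F x) = {x}"
      using cubical_subset_iff[OF P x] x by (auto simp: facet_labels_def)
    moreover have "H x facet_of Q"
      using x cubical_facet[OF Q] by auto
    ultimately show ?thesis
      using facet_of_imp_subset by (auto simp: \<phi>_def labelled_face_def)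
  qed
qed

text \<open>Conversely, being cubical is visible in the face lattice: facets are the nonempty coatoms, and
  two faces are disjoint exactly if the empty face is the only face below both.\<close>

lemma face_lattice_iso_cubical:
  assumes P: "cubical K P F" and K: "K \<noteq> {}" and Q: "polytope Q" and iso: "face_lattice_iso P Q \<phi>"
  shows "cubical K Q (\<lambda>x. \<phi> (F x))"
proof -
  have bij: "bij_betw \<phi> (face_lattice P) (face_lattice Q)"
    and mono: "\<And>G H. G face_of P \<Longrightarrow> H face_of P \<Longrightarrow> \<phi> G \<subseteq> \<phi> H \<longleftrightarrow> G \<subseteq> H"
    using iso by (auto simp: face_lattice_iso_def face_lattice_def)
  have face: "\<phi> G face_of Q" if "G face_of P" for G
    using bij_betwE[OF bij] that by (auto simp: face_lattice_def)
  have surj: "\<exists>H. H face_of P \<and> \<phi> H = G" if "G face_of Q" for G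
  proof -
    have "G \<in> \<phi> ` face_lattice P"
      unfolding bij_betw_imp_surj_on[OF bij] using that by (simp add: face_lattice_def)
    then show ?thesis
      by (auto simp: face_lattice_def)
  qed
  have inj: "\<phi> G = \<phi> H \<longleftrightarrow> G = H" if "G face_of P" "H face_of P" for G H
    using mono[OF that] mono[OF that(2,1)] by auto
  note pP = cubical_polytope[OF P]
  have PP: "P face_of P" "Q face_of Q"
    using pP Q by (simp_all add: face_of_refl polytope_imp_convex)
  have bot: "\<phi> {} = {}"
    by (metis empty_face_of empty_subsetI mono subset_empty surj)
  have top: "\<phi> P = Q"
    by (metis PP face face_of_imp_subset mono subset_antisym surj)
  have facet: "\<phi> G facet_of Q \<longleftrightarrow> G facet_of P" if G: "G face_of P" for G
  proof -
    have "\<phi> G = {} \<longleftrightarrow> G = {}" "\<phi> G = Q \<longleftrightarrow> G = P"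
      using inj[OF G] bot top PP(1) by (metis empty_face_of, metis)
    moreover have "(\<forall>H. H face_of Q \<and> \<phi> G \<subseteq> H \<longrightarrow> H = \<phi> G \<or> H = Q) \<longleftrightarrow>
        (\<forall>H. H face_of P \<and> G \<subseteq> H \<longrightarrow> H = G \<or> H = P)"
      by (metis G PP(1) face inj mono surj top)
    ultimately show ?thesis
      using G face[OF G] by (simp add: facet_of_iff_maximal[OF Q] facet_of_iff_maximal[OF pP])
  qed
  have Ff: "F (i, e) face_of P" if "i \<in> K" for i e
    using cubical_facet[OF P that] by (rule facet_of_imp_face_of)
  have "facets Q = (\<lambda>x. \<phi> (F x)) ` (K \<times> UNIV)"
  proof (rule set_eqI)
    fix G
    have "G \<in> facets Q \<longleftrightarrow> (\<exists>H. H facet_of P \<and> G = \<phi> H)"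
      unfolding facets_def mem_Collect_eq using facet surj facet_of_imp_face_of by metis
    also have "\<dots> \<longleftrightarrow> G \<in> \<phi> ` facets P"
      by (auto simp: facets_def)
    also have "\<phi> ` facets P = (\<lambda>x. \<phi> (F x)) ` (K \<times> UNIV)"
      by (simp add: cubical_facets[OF P] image_image)
    finally show "G \<in> facets Q \<longleftrightarrow> G \<in> (\<lambda>x. \<phi> (F x)) ` (K \<times> UNIV)" .
  qed
  moreover have "\<phi> (F (i, True)) \<inter> \<phi> (F (i, False)) = {}" if i: "i \<in> K" for i
  proof -
    obtain H where H: "H face_of P" "\<phi> H = \<phi> (F (i, True)) \<inter> \<phi> (F (i, False))"
      using surj face_of_Int face Ff i by meson
    then have "H \<subseteq> F (i, True)" "H \<subseteq> F (i, False)"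
      using mono[OF H(1) Ff[OF i]] by blast+
    then have "H = {}"
      using cubical_disjoint[OF P i, of True] by auto
    then show ?thesis
      using H bot by simp
  qed
  moreover have "Q \<inter> (\<Inter>i\<in>K. \<phi> (F (i, \<sigma> i))) \<noteq> {}" for \<sigma>
  proof -
    define A where "A = (\<lambda>i. (i, \<sigma> i)) ` K"
    have A: "A \<subseteq> K \<times> UNIV"
      by (auto simp: A_def)
    let ?G = "labelled_face P F A"
    have G: "?G face_of P"
      by (rule labelled_face_face[OF P A])
    have "?G \<noteq> {}"
      using P unfolding labelled_face_def A_def cubical_def by (simp add: image_image)
    then have "\<phi> ?G \<noteq> {}"
      using inj[OF G empty_face_of] bot by auto
    moreover have "\<phi> ?G \<subseteq> Q"
      using face[OF G] by (rule face_of_imp_subset)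
    moreover have "\<phi> ?G \<subseteq> \<phi> (F (i, \<sigma> i))" if "i \<in> K" for i
      using that mono[OF G Ff] by (auto simp: labelled_face_def A_def)
    ultimately show ?thesis
      by blast
  qed
  ultimately show ?thesis
    using Q unfolding cubical_def by blast
qed



section \<open>Shellings of cubical polytopes\<close>

text \<open>Let each pair of opposite labels span the interval between its two positions in the list. The
  condition says that each cut between consecutive positions is bridged by one of these intervals,
  that is, that the intervals overlap in one connected piece.\<close>

definition linked :: "('i \<times> bool) list \<Rightarrow> bool" where
  "linked xs \<longleftrightarrow> (\<forall>k. 0 < k \<and> k < length xs \<longrightarrow>
     (\<exists>i e. (i, e) \<in> set (take k xs) \<and> (i, \<not> e) \<notin> set (take k xs)))"

lemma linkedD:
  assumes "linked xs" "0 < k" "k < length xs"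
  obtains i e where "(i, e) \<in> set (take k xs)" "(i, \<not> e) \<notin> set (take k xs)"
  using assms unfolding linked_def by blast

text \<open>A label whose opposite is absent can be put first and its opposite last; then it bridges all
  cuts, whatever comes in between.\<close>

lemma linked_extension:
  assumes "finite K" and A: "A \<subseteq> K \<times> UNIV" and ie: "(i, e) \<in> A" "(i, \<not> e) \<notin> A"
  shows "\<exists>xs r. distinct xs \<and> set xs = K \<times> UNIV \<and> linked xs \<and> 1 \<le> r \<and> r \<le> length xs \<and>
    set (take r xs) = A"
proof -
  have fin: "finite (K \<times> (UNIV :: bool set))" "finite A"
    using assms(1) A finite_subset[of A] by (simp_all add: finite_subset)
  obtain ys where ys: "distinct ys" "set ys = A - {(i, e)}"
    using finite_distinct_list[of "A - {(i, e)}"] fin by auto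
  obtain zs where zs: "distinct zs" "set zs = K \<times> UNIV - A - {(i, \<not> e)}"
    using finite_distinct_list[of "K \<times> UNIV - A - {(i, \<not> e)}"] fin by auto
  define xs where "xs = (i, e) # ys @ zs @ [(i, \<not> e)]"
  have i: "i \<in> K"
    using A ie by auto
  have "linked xs"
    unfolding linked_def
  proof (intro allI impI)
    fix k assume k: "0 < k \<and> k < length xs"
    then have "take k xs = (i, e) # take (k - 1) (ys @ zs)"
      by (cases k) (auto simp: xs_def)
    then have "(i, e) \<in> set (take k xs)" "set (take k xs) \<subseteq> insert (i, e) (set (ys @ zs))"
      using set_take_subset[of "k - 1" "ys @ zs"] by auto
    moreover have "(i, \<not> e) \<notin> insert (i, e) (set (ys @ zs))"
      using ys zs ie by auto
    ultimately show "\<exists>i e. (i, e) \<in> set (take k xs) \<and> (i, \<not> e) \<notin> set (take k xs)"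
      by blast
  qed
  moreover have "distinct xs"
    using ys zs ie by (auto simp: xs_def)
  moreover have "set xs = K \<times> UNIV"
    using ys zs ie A i by (auto simp: xs_def)
  moreover have "set (take (Suc (length ys)) xs) = A"
    using ys ie by (auto simp: xs_def)
  ultimately show ?thesis
    by (intro exI[of _ xs] exI[of _ "Suc (length ys)"]) (auto simp: xs_def)
qed

lemma linked_prefix_iff:
  assumes "finite K" "A \<subseteq> K \<times> UNIV" "A \<noteq> {}"
  shows "(\<exists>xs r. distinct xs \<and> set xs = K \<times> UNIV \<and> linked xs \<and> 1 \<le> r \<and> r \<le> length xs \<and>
      set (take r xs) = A) \<longleftrightarrow>
    A = K \<times> UNIV \<or> (\<exists>i e. (i, e) \<in> A \<and> (i, \<not> e) \<notin> A)" (is "?L \<longleftrightarrow> ?R")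
proof
  assume ?L
  then obtain xs r where xs: "set xs = K \<times> UNIV" "linked xs" "1 \<le> r" "r \<le> length xs"
    "set (take r xs) = A"
    by blast
  show ?R
  proof (cases "r = length xs")
    case False
    then show ?thesis
      using linkedD[OF xs(2), of r] xs(3-5) by force
  qed (use xs in auto)
next
  assume ?R
  then consider i e where "(i, e) \<in> A" "(i, \<not> e) \<notin> A" | "A = K \<times> UNIV"
    by blast
  then show ?L
  proof cases
    case 1
    then show ?thesis
      by (rule linked_extension[OF assms(1,2)])
  next
    case 2
    then obtain i where "i \<in> K"
      using assms(3) by auto
    then obtain xs r where "distinct xs" "set xs = K \<times> UNIV" "linked xs" "1 \<le> r" "r \<le> length xs"
      using linked_extension[OF assms(1), of "{(i, True)}" i True] by auto
    then show ?thesis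
      using 2 by (intro exI[of _ xs] exI[of _ "length xs"]) auto
  qed
qed

text \<open>This is the condition that a shelling imposes on the facet \<open>x\<close> with earlier labels \<open>T\<close>: those in
  directions other than that of \<open>x\<close>, which are the labels of the ridges that \<open>x\<close> shares with earlier
  facets, form a nonempty initial segment of a linked order. If \<open>K\<close> has just one direction, there
  are no ridges and the condition is void.\<close>

definition link_condition :: "'i set \<Rightarrow> 'i \<times> bool \<Rightarrow> ('i \<times> bool) set \<Rightarrow> bool" where
  "link_condition K x T \<longleftrightarrow> (let A = T \<inter> ((K - {fst x}) \<times> UNIV) in
     A = (K - {fst x}) \<times> UNIV \<or> (\<exists>i e. (i, e) \<in> A \<and> (i, \<not> e) \<notin> A))"

lemma nth_notin_set_take: "distinct xs \<Longrightarrow> j < length xs \<Longrightarrow> xs ! j \<notin> set (take j xs)"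
  by (auto simp: in_set_conv_nth nth_eq_iff_index_eq)

text \<open>If a cut is not bridged, the label before it violates the link condition: the earlier labels in
  other directions are complete pairs, but not all of them. If all cuts are bridged, the link
  condition at \<open>x\<close> is witnessed by a bridge of the cut before \<open>x\<close>; should the pair of \<open>x\<close> be this
  bridge, it ends there, and a bridge of the next cut serves instead.\<close>

lemma linked_iff_link_condition:
  assumes xs: "distinct xs" "set xs = K \<times> UNIV"
  shows "linked xs \<longleftrightarrow>
    (\<forall>j. 0 < j \<and> j < length xs \<longrightarrow> link_condition K (xs ! j) (set (take j xs)))"
proof
  assume L: "linked xs"
  show "\<forall>j. 0 < j \<and> j < length xs \<longrightarrow> link_condition K (xs ! j) (set (take j xs))"
  proof (intro allI impI)
    fix j assume j: "0 < j \<and> j < length xs"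
    obtain i e where ie: "xs ! j = (i, e)"
      by (cases "xs ! j")
    have take: "set (take (Suc j) xs) = insert (i, e) (set (take j xs))"
      using j ie by (simp add: take_Suc_conv_app_nth)
    obtain k d where k: "(k, d) \<in> set (take j xs)" "(k, \<not> d) \<notin> set (take j xs)"
      using linkedD[OF L] j by blast
    have kK: "k \<in> K"
      using k(1) xs(2) by (auto dest: in_set_takeD)
    show "link_condition K (xs ! j) (set (take j xs))"
    proof (cases "k = i")
      case False
      then show ?thesis
        using k kK by (auto simp: link_condition_def Let_def ie)
    next
      case True
      have "(i, e) \<notin> set (take j xs)"
        using nth_notin_set_take[OF xs(1), of j] j ie by simp
      then have d: "(i, \<not> e) \<in> set (take j xs)"
        using k(1) True by (cases d; cases e) auto
      show ?thesis
      proof (cases "Suc j = length xs")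
        case True
        then have "insert (i, e) (set (take j xs)) = K \<times> UNIV"
          using take xs(2) by simp
        then have "set (take j xs) \<inter> ((K - {i}) \<times> UNIV) = (K - {i}) \<times> UNIV"
          by blast
        then show ?thesis
          by (simp add: link_condition_def ie)
      next
        case False
        then obtain l c where l: "(l, c) \<in> insert (i, e) (set (take j xs))"
          "(l, \<not> c) \<notin> insert (i, e) (set (take j xs))"
          using linkedD[OF L, of "Suc j"] j take by auto
        then have "l \<noteq> i"
          using d by (cases c; cases e) auto
        moreover have "l \<in> K"
          using l(1) \<open>l \<noteq> i\<close> xs(2) by (auto dest: in_set_takeD)
        ultimately show ?thesis
          using l by (auto simp: link_condition_def Let_def ie)
      qed
    qed
  qed
next
  assume R: "\<forall>j. 0 < j \<and> j < length xs \<longrightarrow> link_condition K (xs ! j) (set (take j xs))"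
  show "linked xs"
    unfolding linked_def
  proof (intro allI impI, rule ccontr)
    fix k assume k: "0 < k \<and> k < length xs"
      and neg: "\<not> (\<exists>i e. (i, e) \<in> set (take k xs) \<and> (i, \<not> e) \<notin> set (take k xs))"
    then have closed: "(l, \<not> c) \<in> set (take k xs)" if "(l, c) \<in> set (take k xs)" for l c
      using that by blast
    define j where "j = k - 1"
    have j: "k = Suc j" "j < length xs"
      using k by (auto simp: j_def)
    obtain i e where ie: "xs ! j = (i, e)"
      by (cases "xs ! j")
    have take: "set (take k xs) = insert (i, e) (set (take j xs))"
      using j ie by (simp add: take_Suc_conv_app_nth)
    have "(i, \<not> e) \<in> set (take j xs)"
      using closed[of i e] take by (cases e) auto
    then have "0 < j"
      by (cases j) auto
    then have lc: "link_condition K (i, e) (set (take j xs))"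
      using R j ie by metis
    define A where "A = set (take j xs) \<inter> ((K - {i}) \<times> UNIV)"
    have "(l, \<not> c) \<in> A" if "(l, c) \<in> A" for l c
      using that closed[of l c] take by (auto simp: A_def)
    moreover have "A = (K - {i}) \<times> UNIV \<or> (\<exists>l c. (l, c) \<in> A \<and> (l, \<not> c) \<notin> A)"
      using lc by (simp add: link_condition_def Let_def A_def)
    ultimately have "A = (K - {i}) \<times> UNIV"
      by blast
    moreover have "i \<in> K"
      using ie j xs(2) by (metis SigmaD1 nth_mem)
    moreover have "(i, d) \<in> set (take k xs)" for d
      using take \<open>(i, \<not> e) \<in> set (take j xs)\<close> by (cases d; cases e) auto
    ultimately have "K \<times> UNIV \<subseteq> set (take k xs)"
      using take by (auto simp: A_def)
    moreover have "xs ! k \<in> K \<times> UNIV"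
      using k nth_mem[of k xs] unfolding xs(2) by simp
    ultimately have "xs ! k \<in> set (take k xs)"
      by (rule subsetD)
    then show False
      using nth_notin_set_take[OF xs(1), of k] k by simp
  qed
qed

lemma facet_ordering_map:
  assumes "cubical K P F" "distinct xs" "set xs = K \<times> UNIV"
  shows "facet_ordering P (map F xs)"
  using assms cubical_inj_on[OF assms(1)] cubical_facets[OF assms(1)]
  by (simp add: facet_ordering_def distinct_map)

lemma facet_ordering_labels:
  assumes C: "cubical K P F" and "facet_ordering P Fs"
  obtains xs where "Fs = map F xs" "distinct xs" "set xs = K \<times> UNIV"
proof
  let ?g = "inv_into (K \<times> UNIV) F"
  have Fs: "distinct Fs" "set Fs = F ` (K \<times> UNIV)"
    using assms cubical_facets[OF C] by (auto simp: facet_ordering_def)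
  show "Fs = map F (map ?g Fs)"
    unfolding map_map by (rule map_idI[symmetric]) (simp add: Fs(2) f_inv_into_f)
  show "distinct (map ?g Fs)"
    using Fs inj_on_inv_into[of "set Fs" F "K \<times> UNIV"] by (simp add: distinct_map)
  show "set (map ?g Fs) = K \<times> UNIV"
    using Fs(2) inv_into_image_cancel[OF cubical_inj_on[OF C]] by simp
qed

lemma shelling_iff:
  assumes "polytope P" "aff_dim P \<ge> 2" "facet_ordering P Fs"
  shows "shelling P Fs \<longleftrightarrow> (\<exists>Gs. shelling (Fs ! 0) Gs) \<and>
    (\<forall>j. 0 < j \<and> j < length Fs \<longrightarrow>
          Fs ! j \<inter> \<Union> (set (take j Fs)) \<noteq> {} \<and>
          (\<exists>Gs r. shelling (Fs ! j) Gs \<and> 1 \<le> r \<and> r \<le> length Gs \<and>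
             Fs ! j \<inter> \<Union> (set (take j Fs)) = \<Union> (set (take r Gs))))"
  using assms by (subst shelling.simps) auto

lemma shelling_facet_ordering: "shelling P Fs \<Longrightarrow> facet_ordering P Fs"
  by (cases rule: shelling.cases)

text \<open>The set of ridges of a facet that is covered by earlier facets can be recovered from its union,
  and the induction hypothesis translates the existence of a shelling of the facet beginning with
  these ridges into the link condition.\<close>

lemma cubical_shelling_iff_linked:
  assumes "finite K" "K \<noteq> {}" "cubical K P F" "distinct xs" "set xs = K \<times> UNIV"
  shows "shelling P (map F xs) \<longleftrightarrow> linked xs"
  using assms
proof (induction "card K" arbitrary: K P F xs rule: less_induct)
  case less
  note fin = less.prems(1) and C = less.prems(3) and xs = less.prems(4,5)
  note P = cubical_polytope[OF C]
  have fo: "facet_ordering P (map F xs)"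
    using facet_ordering_map[OF C xs] .
  have dim: "aff_dim P = int (card K)"
    using cubical_aff_dim[OF fin C] .
  have len: "length xs = 2 * card K"
    using distinct_card[OF xs(1)] xs(2) by (simp add: card_cartesian_product)
  have "card K > 0"
    using less.prems by (simp add: card_gt_0_iff)
  then consider "card K = 1" | "card K \<ge> 2"
    by linarith
  then show ?case
  proof cases
    case 1
    have "shelling P (map F xs)"
      using P dim fo 1 by (intro shelling.dim_one) auto
    moreover have "linked xs"
      unfolding linked_def
    proof (intro allI impI)
      fix k assume "0 < k \<and> k < length xs"
      then have k: "k = 1"
        using len 1 by simp
      obtain i e where "xs ! 0 = (i, e)"
        by (cases "xs ! 0")
      then have "set (take k xs) = {(i, e)}"
        using len 1 k by (cases xs) auto
      then show "\<exists>i e. (i, e) \<in> set (take k xs) \<and> (i, \<not> e) \<notin> set (take k xs)"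
        by auto
    qed
    ultimately show ?thesis
      by simp
  next
    case 2
    have len0: "0 < length xs"
      using len 2 by simp
    have facet: "(\<exists>Gs r. shelling (F x) Gs \<and> 1 \<le> r \<and> r \<le> length Gs \<and>
          \<Union> ((\<lambda>y. F x \<inter> F y) ` A) = \<Union> (set (take r Gs))) \<longleftrightarrow>
        A = (K - {fst x}) \<times> UNIV \<or> (\<exists>i e. (i, e) \<in> A \<and> (i, \<not> e) \<notin> A)"
      if x: "x \<in> K \<times> UNIV" and A: "A \<subseteq> (K - {fst x}) \<times> UNIV" "A \<noteq> {}" for x A
    proof -
      obtain i e where ie: "x = (i, e)" "i \<in> K"
        using x by auto
      let ?K = "K - {i}" and ?H = "\<lambda>y. F x \<inter> F y"
      have CG: "cubical ?K (F x) ?H"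
        using cubical_facet_cubical[OF C ie(2)] ie(1) by simp
      have "card ?K = card K - 1"
        using ie(2) by simp
      then have "finite ?K" "card ?K < card K" "card ?K \<noteq> 0"
        using fin 2 by auto
      then have K': "finite ?K" "?K \<noteq> {}" "card ?K < card K"
        by auto
      have IH: "shelling (F x) (map ?H ys) \<longleftrightarrow> linked ys"
        if "distinct ys" "set ys = ?K \<times> UNIV" for ys
        using less.hyps[OF K'(3,1,2) CG that] .
      have un: "\<Union> (?H ` A) = \<Union> (?H ` B) \<longleftrightarrow> A = B" if "B \<subseteq> ?K \<times> UNIV" for B
      proof -
        have A': "A \<subseteq> ?K \<times> UNIV"
          using A ie by simp
        have "\<Union> (?H ` A) = \<Union> (?H ` B) \<longleftrightarrow> ?H ` A = ?H ` B"
          by (rule facets_Union_eq_iff[OF cubical_polytope[OF CG]])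
            (use A' that cubical_facets[OF CG] in auto)
        also have "\<dots> \<longleftrightarrow> A = B"
          by (rule inj_on_image_eq_iff[OF cubical_inj_on[OF CG] A' that])
        finally show ?thesis .
      qed
      have "(\<exists>Gs r. shelling (F x) Gs \<and> 1 \<le> r \<and> r \<le> length Gs \<and>
          \<Union> (?H ` A) = \<Union> (set (take r Gs))) \<longleftrightarrow>
        (\<exists>ys r. distinct ys \<and> set ys = ?K \<times> UNIV \<and> linked ys \<and> 1 \<le> r \<and> r \<le> length ys \<and>
          set (take r ys) = A)" (is "?L \<longleftrightarrow> ?R")
      proof
        assume ?L
        then obtain Gs r where Gs: "shelling (F x) Gs" "1 \<le> r" "r \<le> length Gs"
          "\<Union> (?H ` A) = \<Union> (set (take r Gs))"
          by blast
        obtain ys where ys: "Gs = map ?H ys" "distinct ys" "set ys = ?K \<times> UNIV"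
          using facet_ordering_labels[OF CG shelling_facet_ordering[OF Gs(1)]] .
        have "set (take r ys) \<subseteq> ?K \<times> UNIV"
          using ys(3) set_take_subset by metis
        moreover have "\<Union> (?H ` A) = \<Union> (?H ` set (take r ys))"
          using Gs(4) unfolding ys(1) take_map set_map .
        ultimately have "A = set (take r ys)"
          using un by blast
        then show ?R
          using Gs ys IH[OF ys(2,3)] by auto
      next
        assume ?R
        then obtain ys r where ys: "distinct ys" "set ys = ?K \<times> UNIV" "linked ys" "1 \<le> r"
          "r \<le> length ys" "set (take r ys) = A"
          by blast
        then show ?L
          using IH[OF ys(1,2)]
          by (intro exI[of _ "map ?H ys"] exI[of _ r]) (simp add: take_map)
      qed
      also have "\<dots> \<longleftrightarrow> A = ?K \<times> UNIV \<or> (\<exists>i e. (i, e) \<in> A \<and> (i, \<not> e) \<notin> A)"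
        using A ie K' by (intro linked_prefix_iff) auto
      finally show ?thesis
        using ie(1) by simp
    qed
    have pos: "map F xs ! j \<inter> \<Union> (set (take j (map F xs))) \<noteq> {} \<and>
        (\<exists>Gs r. shelling (map F xs ! j) Gs \<and> 1 \<le> r \<and> r \<le> length Gs \<and>
          map F xs ! j \<inter> \<Union> (set (take j (map F xs))) = \<Union> (set (take r Gs))) \<longleftrightarrow>
        link_condition K (xs ! j) (set (take j xs))"
      if j: "0 < j" "j < length xs" for j
    proof -
      obtain i e where ie: "xs ! j = (i, e)"
        by (cases "xs ! j")
      have xj: "xs ! j \<in> K \<times> UNIV"
        using j nth_mem[of j xs] unfolding xs(2) by simp
      then have i: "i \<in> K"
        using ie by simp
      define T where "T = set (take j xs)"
      define A where "A = T \<inter> ((K - {i}) \<times> UNIV)"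
      have T: "T \<subseteq> K \<times> UNIV"
        using xs(2) set_take_subset unfolding T_def by metis
      have "(i, e) \<notin> T"
        using nth_notin_set_take[OF xs(1) j(2)] ie by (simp add: T_def)
      have opp: "y \<in> A \<or> y = (i, \<not> e)" if "y \<in> T" for y
      proof -
        obtain k d where y: "y = (k, d)"
          by (cases y)
        then show ?thesis
          using that T \<open>(i, e) \<notin> T\<close> by (cases "k = i"; cases d; cases e) (auto simp: A_def)
      qed
      have eq: "F (i, e) \<inter> \<Union> (F ` T) = \<Union> ((\<lambda>y. F (i, e) \<inter> F y) ` A)"
      proof
        show "F (i, e) \<inter> \<Union> (F ` T) \<subseteq> \<Union> ((\<lambda>y. F (i, e) \<inter> F y) ` A)"
        proof
          fix z assume "z \<in> F (i, e) \<inter> \<Union> (F ` T)"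
          then obtain y where y: "z \<in> F (i, e)" "y \<in> T" "z \<in> F y"
            by blast
          then have "y \<noteq> (i, \<not> e)"
            using cubical_disjoint[OF C i, of e] by blast
          then show "z \<in> \<Union> ((\<lambda>y. F (i, e) \<inter> F y) ` A)"
            using y opp by blast
        qed
      qed (auto simp: A_def)
      have nonempty: "\<Union> ((\<lambda>y. F (i, e) \<inter> F y) ` A) \<noteq> {}" if "A \<noteq> {}"
      proof -
        obtain y where y: "y \<in> A"
          using \<open>A \<noteq> {}\<close> by auto
        have "(\<lambda>y. F (i, e) \<inter> F y) y \<in> facets (F (i, e))"
          using y cubical_facets[OF cubical_facet_cubical[OF C i, of e]] by (auto simp: A_def)
        then have "F (i, e) \<inter> F y \<noteq> {}"
          by (auto simp: facets_def facet_of_def)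
        then show ?thesis
          using y by blast
      qed
      have "K - {i} \<noteq> {}"
      proof
        assume "K - {i} = {}"
        then have "card K \<le> card {i}"
          by (intro card_mono) auto
        then show False
          using 2 by simp
      qed
      then have "link_condition K (i, e) T \<Longrightarrow> A \<noteq> {}"
        by (auto simp: link_condition_def Let_def A_def)
      moreover have "link_condition K (i, e) T \<longleftrightarrow>
          A = (K - {i}) \<times> UNIV \<or> (\<exists>i e. (i, e) \<in> A \<and> (i, \<not> e) \<notin> A)"
        by (simp add: link_condition_def Let_def A_def)
      moreover have "A \<subseteq> (K - {fst (i, e)}) \<times> UNIV"
        by (auto simp: A_def)
      ultimately have "\<Union> ((\<lambda>y. F (i, e) \<inter> F y) ` A) \<noteq> {} \<and>
          (\<exists>Gs r. shelling (F (i, e)) Gs \<and> 1 \<le> r \<and> r \<le> length Gs \<and>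
            \<Union> ((\<lambda>y. F (i, e) \<inter> F y) ` A) = \<Union> (set (take r Gs))) \<longleftrightarrow>
          link_condition K (i, e) T"
        using facet[of "(i, e)" A] i nonempty by (cases "A = {}") auto
      then show ?thesis
        unfolding eq[symmetric] T_def using j by (simp add: take_map ie)
    qed
    have first: "\<exists>Gs. shelling (map F xs ! 0) Gs"
    proof -
      have x: "xs ! 0 \<in> K \<times> UNIV"
        using nth_mem[OF len0] xs(2) by simp
      have "card (K - {fst (xs ! 0)}) \<noteq> 0"
        using x 2 by auto
      then have "K - {fst (xs ! 0)} \<noteq> {}"
        by (metis card.empty)
      then have "(K - {fst (xs ! 0)}) \<times> (UNIV :: bool set) \<noteq> {}"
        by simp
      then show ?thesis
        using facet[OF x, of "(K - {fst (xs ! 0)}) \<times> UNIV"] len0 by auto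
    qed
    have "shelling P (map F xs) \<longleftrightarrow>
        (\<forall>j. 0 < j \<and> j < length xs \<longrightarrow> link_condition K (xs ! j) (set (take j xs)))"
      using shelling_iff[OF P _ fo] dim 2 first pos by (simp add: length_map cong: conj_cong imp_cong)
    then show ?thesis
      using linked_iff_link_condition[OF xs] by simp
  qed
qed



section \<open>Line shellings are linked\<close>

text \<open>The functionals \<open>l\<close> are the facet inequalities of the cone over a cubical polytope. Working in the
  cone treats the points of a line before, at and after infinity alike.\<close>

locale cubical_cone =
  fixes l :: "'i::finite \<times> bool \<Rightarrow> 'v::real_vector \<Rightarrow> real"
  assumes linear: "linear (l x)"
    and pointed: "(\<And>x. 0 \<le> l x z) \<Longrightarrow> l (i, True) z = 0 \<Longrightarrow> l (i, False) z = 0 \<Longrightarrow> z = 0"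
    and vertex: "\<exists>z. \<forall>i e. (e = \<sigma> i \<longrightarrow> l (i, e) z = 0) \<and> (e \<noteq> \<sigma> i \<longrightarrow> 0 < l (i, e) z)"
begin

lemma lin: "l x (y + t *\<^sub>R z) = l x y + t * l x z"
  using linear[of x] by (simp add: linear_add linear_scale)

lemma pointed': "(\<And>x. 0 \<le> l x z) \<Longrightarrow> l (i, e) z = 0 \<Longrightarrow> l (i, \<not> e) z = 0 \<Longrightarrow> z = 0"
  using pointed[of z i] by (cases e) auto

text \<open>The sum of two vertices that agree exactly on \<open>S\<close> lies on just the facets that they share.\<close>

lemma face_point:
  obtains q where "\<And>i. i \<in> S \<Longrightarrow> l (i, \<sigma> i) q = 0"
    "\<And>i e. i \<notin> S \<or> e \<noteq> \<sigma> i \<Longrightarrow> 0 < l (i, e) q"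
proof -
  define \<tau> where "\<tau> i = (if i \<in> S then \<sigma> i else \<not> \<sigma> i)" for i
  obtain y where y: "\<And>i e. e = \<sigma> i \<Longrightarrow> l (i, e) y = 0" "\<And>i e. e \<noteq> \<sigma> i \<Longrightarrow> 0 < l (i, e) y"
    using vertex[of \<sigma>] by blast
  obtain z where z: "\<And>i e. e = \<tau> i \<Longrightarrow> l (i, e) z = 0" "\<And>i e. e \<noteq> \<tau> i \<Longrightarrow> 0 < l (i, e) z"
    using vertex[of \<tau>] by blast
  have add: "l x (y + z) = l x y + l x z" for x
    using lin[of x y 1 z] by simp
  show ?thesis
  proof (rule that[of "y + z"])
    show "l (i, \<sigma> i) (y + z) = 0" if "i \<in> S" for i
      using y(1)[of "\<sigma> i" i] z(1)[of "\<sigma> i" i] that by (simp add: add \<tau>_def)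
    show "0 < l (i, e) (y + z)" if "i \<notin> S \<or> e \<noteq> \<sigma> i" for i e
    proof (cases "e = \<sigma> i")
      case True
      then show ?thesis
        using that y(1)[of e i] z(2)[of e i] by (simp add: add \<tau>_def)
    next
      case False
      then show ?thesis
        using y(2)[of e i] z(1)[of e i] z(2)[of e i] by (cases "e = \<tau> i") (simp_all add: add)
    qed
  qed
qed

text \<open>The vector \<open>z\<close> lies in the span of the face on which the functionals \<open>l (k, \<sigma> k)\<close> vanish. The ray
  from a point of this face in direction \<open>z\<close> stays on the inner side of the pairs outside \<open>J\<close>, so it
  could leave the cone only through a facet opposite to one containing the face, which is disjoint
  from it. So \<open>z\<close> lies in the face itself.\<close>

lemma facet_opposite_pos:
  assumes i: "i \<notin> J" and out: "\<And>k e. k \<notin> J \<Longrightarrow> 0 < l (k, e) z"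
    and zero: "\<And>k. k \<in> J \<Longrightarrow> l (k, \<sigma> k) z = 0" and j: "j \<in> J"
  shows "0 < l (j, \<not> \<sigma> j) z"
proof (rule ccontr)
  assume jz: "\<not> 0 < l (j, \<not> \<sigma> j) z"
  define N where "N = {k \<in> J. l (k, \<not> \<sigma> k) z < 0}"
  show False
  proof (cases "N = {}")
    case True
    have nn: "0 \<le> l (k, \<not> \<sigma> k) z" if "k \<in> J" for k
      using True that by (force simp: N_def)
    have "0 \<le> l x z" for x
    proof -
      obtain k e where x: "x = (k, e)"
        by (cases x)
      show ?thesis
        using out[of k e] zero[of k] nn[of k] unfolding x
        by (cases "k \<in> J"; cases "e = \<sigma> k") (auto simp: less_imp_le)
    qed
    moreover have "l (j, \<not> \<sigma> j) z = 0"
      using nn[OF j] jz by simp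
    ultimately have "z = 0"
      using pointed' zero[OF j] by blast
    then show False
      using out[OF i, of True] linear_0[OF linear] by simp
  next
    case False
    obtain q where q: "\<And>k. k \<in> J \<Longrightarrow> l (k, \<sigma> k) q = 0"
      "\<And>k e. k \<notin> J \<or> e \<noteq> \<sigma> k \<Longrightarrow> 0 < l (k, e) q"
      using face_point[of J \<sigma>] by blast
    \<comment> \<open>The last point of the face on the ray from \<open>q\<close> in direction \<open>z\<close> lies on two opposite facets.\<close>
    define f where "f k = l (k, \<not> \<sigma> k) q / - l (k, \<not> \<sigma> k) z" for k
    define t where "t = Min (f ` N)"
    have "t \<in> f ` N"
      unfolding t_def by (rule Min_in) (use False in auto)
    then obtain k where k: "k \<in> N" "t = f k"
      by blast
    have t_le: "t \<le> f m" if "m \<in> N" for m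
      unfolding t_def by (rule Min_le) (use that in auto)
    have kJ: "k \<in> J" and kneg: "l (k, \<not> \<sigma> k) z < 0"
      using k(1) by (auto simp: N_def)
    have t0: "0 \<le> t"
      using q(2)[of k "\<not> \<sigma> k"] kneg unfolding k(2) f_def
      by (intro divide_nonneg_nonneg) auto
    let ?y = "q + t *\<^sub>R z"
    have opp: "0 \<le> l (m, \<not> \<sigma> m) ?y" if m: "m \<in> J" for m
    proof (cases "m \<in> N")
      case True
      then show ?thesis
        using t_le[OF True] by (auto simp: lin f_def N_def field_simps)
    next
      case False
      then have "0 \<le> l (m, \<not> \<sigma> m) z"
        using m by (auto simp: N_def)
      then show ?thesis
        using q(2)[of m "\<not> \<sigma> m"] t0 by (simp add: lin)
    qed
    have outy: "0 < l (m, e) ?y" if "m \<notin> J" for m e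
      using q(2)[of m e] out[OF that, of e] that t0 by (simp add: lin add_pos_nonneg)
    have zeroy: "l (m, \<sigma> m) ?y = 0" if "m \<in> J" for m
      using q(1)[OF that] zero[OF that] by (simp add: lin)
    have "0 \<le> l x ?y" for x
    proof -
      obtain m e where x: "x = (m, e)"
        by (cases x)
      show ?thesis
        using outy[of m e] zeroy[of m] opp[of m] unfolding x
        by (cases "m \<in> J"; cases "e = \<sigma> m") (auto simp: less_imp_le)
    qed
    moreover have "l (k, \<not> \<sigma> k) ?y = 0"
      unfolding lin using kneg by (simp add: k(2) f_def)
    ultimately have "?y = 0"
      using pointed' zeroy[OF kJ] by blast
    then show False
      using outy[OF i, of True] linear_0[OF linear] by simp
  qed
qed

text \<open>A cut of a line shelling that is not bridged gives a vector on which all inequalities of the pairs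
  outside \<open>J\<close> fail and all those of the pairs in \<open>J\<close> hold. Subtracting a multiple of a point of the
  face of \<open>S\<close> makes a further functional of a pair in \<open>J\<close> vanish and keeps the failures. Once each
  pair in \<open>J\<close> has a vanishing functional, the negative of the vector contradicts
  \<open>facet_opposite_pos\<close>, because the functional opposite to the last one to vanish is still
  nonnegative.\<close>

lemma no_unbridged_vector:
  assumes i: "i \<notin> J" and "S \<subset> J"
    and "\<And>k e. k \<notin> J \<Longrightarrow> l (k, e) x < 0"
    and "\<And>k e. k \<in> J - S \<Longrightarrow> 0 \<le> l (k, e) x"
    and "\<And>k. k \<in> S \<Longrightarrow> l (k, \<sigma> k) x = 0"
  shows False
  using assms(2-)
proof (induction "card (J - S)" arbitrary: S \<sigma> x rule: less_induct)
  case less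
  note S = less.prems(1) and neg = less.prems(2) and nn = less.prems(3) and zero = less.prems(4)
  obtain q where q: "\<And>k. k \<in> S \<Longrightarrow> l (k, \<sigma> k) q = 0"
    "\<And>k e. k \<notin> S \<or> e \<noteq> \<sigma> k \<Longrightarrow> 0 < l (k, e) q"
    using face_point[of S \<sigma>] by blast
  define R where "R = (J - S) \<times> (UNIV :: bool set)"
  define f where "f y = l y x / l y q" for y
  define t where "t = Min (f ` R)"
  have fin: "finite (f ` R)" "f ` R \<noteq> {}"
    using S by (auto simp: R_def)
  have "t \<in> f ` R"
    unfolding t_def using fin by (rule Min_in)
  then obtain j e where j: "j \<in> J - S" "t = f (j, e)"
    by (auto simp: R_def)
  have t_le: "t \<le> f (k, d)" if "k \<in> J - S" for k d
    unfolding t_def by (rule Min_le[OF fin(1)]) (use that in \<open>auto simp: R_def\<close>)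
  have t0: "0 \<le> t"
    using nn[OF j(1)] q(2)[of j e] j(1) unfolding j(2) f_def by (simp add: less_imp_le)
  define x' where "x' = x + (- t) *\<^sub>R q"
  have lx': "l y x' = l y x - t * l y q" for y
    using lin[of y x "- t" q] by (simp add: x'_def)
  have neg': "l (k, d) x' < 0" if "k \<notin> J" for k d
  proof -
    have "0 < l (k, d) q"
      using q(2)[of k d] that S by blast
    then have "0 \<le> t * l (k, d) q"
      using t0 by simp
    then show ?thesis
      using neg[OF that, of d] by (simp add: lx')
  qed
  have nn': "0 \<le> l (k, d) x'" if "k \<in> J - S" for k d
    using t_le[OF that, of d] q(2)[of k d] that by (simp add: lx' f_def field_simps)
  define \<sigma>' where "\<sigma>' = \<sigma>(j := e)"
  have zero': "l (k, \<sigma>' k) x' = 0" if "k \<in> insert j S" for k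
  proof (cases "k = j")
    case True
    have "0 < l (j, e) q"
      using q(2)[of j e] j(1) by blast
    then show ?thesis
      unfolding True by (simp add: lx' \<sigma>'_def j(2) f_def)
  next
    case False
    then show ?thesis
      using that zero[of k] q(1)[of k] by (simp add: lx' \<sigma>'_def)
  qed
  show False
  proof (cases "insert j S = J")
    case False
    then have S': "insert j S \<subset> J"
      using S j(1) by blast
    have "card (J - insert j S) < card (J - S)"
      using j(1) by (intro psubset_card_mono) auto
    then show False
      using less.hyps[OF _ S' neg' _ zero'] nn' by blast
  next
    case True
    have neg_x': "l y (- x') = - l y x'" for y
      using linear[of y] by (simp add: linear_neg)
    have "0 < l (j, \<not> \<sigma>' j) (- x')"
      by (rule facet_opposite_pos[OF i]) (use neg' zero' True j(1) in \<open>auto simp: neg_x'\<close>)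
    then show False
      using nn'[OF j(1), of "\<not> \<sigma>' j"] by (simp add: neg_x')
  qed
qed

end

text \<open>A point outside lies beyond the facet through which the segment from an interior point leaves.\<close>

lemma in_polytope_of_facet_inequalities:
  fixes Q :: "'a::euclidean_space set"
  assumes Q: "polytope Q" and p: "p \<in> interior Q"
    and facet: "\<And>G. G facet_of Q \<Longrightarrow> \<exists>a b. G = Q \<inter> {z. a \<bullet> z = b} \<and> a \<bullet> p < b \<and> a \<bullet> y \<le> b"
  shows "y \<in> Q"
proof (rule ccontr)
  assume y: "y \<notin> Q"
  have pQ: "p \<in> Q"
    using p interior_subset by blast
  have "closed_segment p y \<inter> frontier Q \<noteq> {}"
    by (rule connected_Int_frontier) (use pQ y in auto)
  then obtain z where z: "z \<in> closed_segment p y" "z \<in> frontier Q"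
    by blast
  have "frontier Q = Q - rel_interior Q"
    using rel_interior_nonempty_interior[of Q] p polytope_imp_closed[OF Q]
    by (auto simp: frontier_def)
  also have "\<dots> = \<Union> {G. G facet_of Q}"
    by (rule rel_boundary_of_polyhedron[OF polytope_imp_polyhedron[OF Q]])
  finally obtain G where G: "G facet_of Q" "z \<in> G"
    using z(2) by blast
  then obtain a b where ab: "G = Q \<inter> {z. a \<bullet> z = b}" "a \<bullet> p < b" "a \<bullet> y \<le> b"
    using facet by blast
  have az: "a \<bullet> z = b" "z \<in> Q"
    using G(2) ab(1) by auto
  obtain u where u: "z = (1 - u) *\<^sub>R p + u *\<^sub>R y" "0 \<le> u" "u \<le> 1"
    using z(1) by (auto simp: in_segment)
  have "u \<noteq> 1"
    using u(1) y az(2) by auto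
  then have "(1 - u) * (a \<bullet> p) < (1 - u) * b" "u * (a \<bullet> y) \<le> u * b"
    using u ab by (auto intro: mult_left_mono)
  then have "a \<bullet> z < b"
    unfolding u(1) by (simp add: inner_add_right algebra_simps)
  then show False
    using az by simp
qed

text \<open>An unbridged cut separates the inverse crossing times of complete pairs, and a parameter between
  them gives a vector that \<open>no_unbridged_vector\<close> excludes.\<close>

lemma line_shelling_linked:
  fixes F :: "'i::finite \<times> bool \<Rightarrow> 'a::euclidean_space set"
  assumes C: "cubical UNIV Q F" and L: "line_shelling Q p v (map F xs)"
    and xs: "distinct xs" "set xs = UNIV"
  shows "linked xs"
proof -
  note Q = cubical_polytope[OF C]
  have p: "p \<in> interior Q" and gp: "general_position Q p v"
    and sorted: "sorted_wrt (\<lambda>F G. crossed_before (crossing_time p v F) (crossing_time p v G)) (map F xs)"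
    using L by (auto simp: line_shelling_def)
  have facet: "F x facet_of Q" for x
    using cubical_facet[OF C, of "fst x" "snd x"] by simp
  have "\<exists>a b. a \<noteq> 0 \<and> Q \<subseteq> {y. a \<bullet> y \<le> b} \<and> F x = Q \<inter> {y. a \<bullet> y = b}" for x
    using facet_of_polyhedron[OF polytope_imp_polyhedron[OF Q] facet] by metis
  then obtain a b where ab0:
    "\<And>x. a x \<noteq> 0 \<and> Q \<subseteq> {y. a x \<bullet> y \<le> b x} \<and> F x = Q \<inter> {y. a x \<bullet> y = b x}"
    by metis
  then have ab: "\<And>x. a x \<noteq> 0" "\<And>x y. y \<in> Q \<Longrightarrow> a x \<bullet> y \<le> b x"
    "\<And>x. F x = Q \<inter> {y. a x \<bullet> y = b x}"
    by blast+
  have ap: "a x \<bullet> p < b x" for x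
  proof -
    have "interior Q \<subseteq> interior {y. a x \<bullet> y \<le> b x}"
      by (rule interior_mono) (use ab(2)[of _ x] in auto)
    then show ?thesis
      using p ab(1)[of x] by (auto simp: interior_halfspace_le)
  qed
  have inQ: "y \<in> Q" if "\<And>x. a x \<bullet> y \<le> b x" for y
  proof (rule in_polytope_of_facet_inequalities[OF Q p])
    fix G assume "G facet_of Q"
    then obtain i e where "G = F (i, e)"
      using cubical_facetE[OF C] by metis
    then show "\<exists>a b. G = Q \<inter> {z. a \<bullet> z = b} \<and> a \<bullet> p < b \<and> a \<bullet> y \<le> b"
      using ab(3) ap that by blast
  qed
  define l where "l x z = snd z * b x - a x \<bullet> fst z" for x and z :: "'a \<times> real"
  interpret cubical_cone l
  proof (rule cubical_cone.intro)
    show "linear (l x)" for x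
      by (rule linearI) (simp_all add: l_def inner_add_right algebra_simps)
    show "z = 0" if nn: "\<And>x. 0 \<le> l x z" and opp: "l (i, True) z = 0" "l (i, False) z = 0" for z i
    proof -
      obtain y \<tau> where z: "z = (y, \<tau>)"
        by (cases z)
      have ay: "a x \<bullet> y \<le> \<tau> * b x" for x
        using nn[of x] by (simp add: l_def z)
      show ?thesis
      proof (cases "\<tau> > 0")
        case True
        define w where "w = (1 / \<tau>) *\<^sub>R y"
        have aw: "a x \<bullet> w = (a x \<bullet> y) / \<tau>" for x
          by (simp add: w_def)
        have "w \<in> Q"
          by (rule inQ) (use ay True in \<open>simp add: aw divide_le_eq mult.commute\<close>)
        moreover have "a (i, e) \<bullet> w = b (i, e)" for e
          using opp True by (cases e) (simp_all add: aw l_def z field_simps)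
        ultimately have "w \<in> F (i, True) \<inter> F (i, False)"
          using ab(3) by auto
        then show ?thesis
          using cubical_disjoint[OF C, of i True] by auto
      next
        case False
        \<comment> \<open>Otherwise \<open>y - \<tau> p\<close> is a direction in which \<open>Q\<close> would be unbounded.\<close>
        define r where "r = y - \<tau> *\<^sub>R p"
        have ar: "a x \<bullet> r \<le> 0" for x
        proof -
          have "\<tau> * (b x - a x \<bullet> p) \<le> 0"
            using False ap[of x] by (intro mult_nonpos_nonneg) auto
          then show ?thesis
            using ay[of x] by (simp add: r_def inner_diff_right algebra_simps)
        qed
        have ray: "p + s *\<^sub>R r \<in> Q" if "0 \<le> s" for s
        proof (rule inQ)
          fix x
          have "s * (a x \<bullet> r) \<le> 0"
            using ar[of x] that by (simp add: mult_nonneg_nonpos)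
          then show "a x \<bullet> (p + s *\<^sub>R r) \<le> b x"
            using ap[of x] by (simp add: inner_add_right)
        qed
        have "r = 0"
        proof (rule ccontr)
          assume r: "r \<noteq> 0"
          obtain B where B: "\<And>y. y \<in> Q \<Longrightarrow> norm y \<le> B"
            using polytope_imp_bounded[OF Q] by (auto simp: bounded_iff)
          define s where "s = (B + norm p + 1) / norm r"
          have "0 \<le> B"
            using order_trans[OF norm_ge_zero B[OF ray[of 0]]] by simp
          then have s: "0 \<le> s" "norm (s *\<^sub>R r) = B + norm p + 1"
            using r by (auto simp: s_def)
          have "norm (s *\<^sub>R r) \<le> norm (p + s *\<^sub>R r) + norm p"
            using norm_triangle_ineq4[of "p + s *\<^sub>R r" p] by simp
          then show False
            using B[OF ray[OF s(1)]] s(2) by simp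
        qed
        then have y: "y = \<tau> *\<^sub>R p"
          by (simp add: r_def)
        have "0 \<le> \<tau> * (b (i, True) - a (i, True) \<bullet> p)"
          using ay[of "(i, True)"] by (simp add: y algebra_simps)
        then have "\<tau> = 0"
          using False ap[of "(i, True)"] by (simp add: zero_le_mult_iff)
        then show ?thesis
          by (simp add: z y zero_prod_def)
      qed
    qed
    show "\<exists>z. \<forall>i e. (e = \<sigma> i \<longrightarrow> l (i, e) z = 0) \<and> (e \<noteq> \<sigma> i \<longrightarrow> 0 < l (i, e) z)" for \<sigma>
    proof -
      obtain w where w: "w \<in> Q" "\<And>i e. w \<in> F (i, e) \<longleftrightarrow> e = \<sigma> i"
        using cubical_vertex[OF C, of \<sigma>] by auto
      have "(e = \<sigma> i \<longrightarrow> l (i, e) (w, 1) = 0) \<and> (e \<noteq> \<sigma> i \<longrightarrow> 0 < l (i, e) (w, 1))" for i e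
      proof -
        have "w \<in> F (i, e) \<longleftrightarrow> a (i, e) \<bullet> w = b (i, e)"
          using ab(3)[of "(i, e)"] w(1) by simp
        then show ?thesis
          using w(2)[of i e] ab(2)[OF w(1), of "(i, e)"] by (auto simp: l_def)
      qed
      then show ?thesis
        by blast
    qed
  qed
  define t where "t x = crossing_time p v (F x)" for x
  have cross: "a x \<bullet> p + t x * (a x \<bullet> v) = b x" for x
  proof -
    have "F x \<in> facets Q"
      using facet by (simp add: facets_def)
    then have "p + t x *\<^sub>R v \<in> affine hull F x"
      using gp theI'[of "\<lambda>t. p + t *\<^sub>R v \<in> affine hull F x"]
      unfolding general_position_def t_def crossing_time_def by blast
    also have "affine hull F x \<subseteq> {y. a x \<bullet> y = b x}"
      by (rule hull_minimal) (use ab(3) in \<open>auto simp: affine_hyperplane\<close>)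
    finally show ?thesis
      by (simp add: inner_add_right)
  qed
  have t0: "t x \<noteq> 0" for x
    using cross[of x] ap[of x] by auto
  \<comment> \<open>For \<open>\<mu> > 0\<close> this vector represents the point of the line with parameter \<open>1 / \<mu>\<close>. In terms
    of \<open>1 / t\<close> the order of the line shelling is just the decreasing order.\<close>
  have l_line: "l x (v + \<mu> *\<^sub>R p, \<mu>) = (b x - a x \<bullet> p) * (\<mu> - 1 / t x)" for x \<mu>
  proof -
    have "a x \<bullet> v = (b x - a x \<bullet> p) / t x"
      using cross[of x] t0[of x] by (simp add: field_simps)
    then show ?thesis
      by (simp add: l_def inner_add_right diff_divide_distrib algebra_simps)
  qed
  have inverse_less: "1 / t' < 1 / s" if "crossed_before s t'" for s t' :: real
    using that unfolding crossed_before_def by (auto simp: field_simps)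
  have decr: "1 / t (xs ! n) < 1 / t (xs ! m)" if "m < n" "n < length xs" for m n
    using sorted_wrt_nth_less[OF sorted, of m n] that by (intro inverse_less) (simp add: t_def)
  show ?thesis
    unfolding linked_def
  proof (intro allI impI, rule ccontr)
    fix k assume k: "0 < k \<and> k < length xs"
      and neg: "\<not> (\<exists>i e. (i, e) \<in> set (take k xs) \<and> (i, \<not> e) \<notin> set (take k xs))"
    define A where "A = set (take k xs)"
    define J where "J = {i. (i, True) \<notin> A}"
    have A: "(i, e) \<in> A \<longleftrightarrow> i \<notin> J" for i e
      using neg unfolding A_def[symmetric] J_def by (cases e) (auto, metis, metis)
    obtain \<mu> where \<mu>: "1 / t (xs ! k) < \<mu>" "\<mu> < 1 / t (xs ! (k - 1))"
      using dense[OF decr[of "k - 1" k]] k by auto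
    have early: "l x (v + \<mu> *\<^sub>R p, \<mu>) < 0" if x: "x \<in> A" for x
    proof -
      obtain m where m: "m < k" "x = xs ! m"
        using x k unfolding A_def by (auto simp: in_set_conv_nth)
      have "1 / t (xs ! (k - 1)) \<le> 1 / t x"
      proof (cases "m = k - 1")
        case False
        then have "m < k - 1" "k - 1 < length xs"
          using m(1) k by auto
        then show ?thesis
          using decr m(2) by (simp add: less_imp_le)
      qed (simp add: m(2))
      then show ?thesis
        using \<mu>(2) ap[of x] by (simp add: l_line mult_pos_neg)
    qed
    have late: "0 \<le> l x (v + \<mu> *\<^sub>R p, \<mu>)" if x: "x \<notin> A" for x
    proof -
      obtain m where m: "m < length xs" "x = xs ! m"
        using xs(2) by (metis UNIV_I in_set_conv_nth)
      then have "k \<le> m"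
        using x k unfolding A_def by (metis in_set_conv_nth length_take min.absorb4 not_less nth_take)
      then have "1 / t x \<le> 1 / t (xs ! k)"
      proof (cases "m = k")
        case False
        then show ?thesis
          using decr[of k m] \<open>k \<le> m\<close> m by (simp add: less_imp_le)
      qed (simp add: m(2))
      then show ?thesis
        using \<mu>(1) ap[of x] by (simp add: l_line)
    qed
    have "xs ! 0 \<in> A"
      using k by (auto simp: A_def in_set_conv_nth)
    then have i: "fst (xs ! 0) \<notin> J"
      using A[of "fst (xs ! 0)" "snd (xs ! 0)"] by simp
    have "xs ! k \<notin> A"
      using nth_notin_set_take[OF xs(1)] k by (simp add: A_def)
    then have "fst (xs ! k) \<in> J"
      using A[of "fst (xs ! k)" "snd (xs ! k)"] by simp
    then have "{} \<subset> J"
      by blast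
    then show False
      by (rule no_unbridged_vector[OF i]) (use A early late in auto)
  qed
qed



section \<open>Cubical polytopes given by inequalities\<close>

lemma polytope_inequalities:
  fixes w :: "'i::finite \<Rightarrow> 'a::euclidean_space"
  assumes "bounded {y. \<forall>x. w x \<bullet> y \<le> b x}"
  shows "polytope {y. \<forall>x. w x \<bullet> y \<le> b x}"
proof -
  have "{y. \<forall>x. w x \<bullet> y \<le> b x} = \<Inter> (range (\<lambda>x. {y. w x \<bullet> y \<le> b x}))"
    by auto
  also have "polyhedron \<dots>"
    by (rule polyhedron_Inter) (auto simp: polyhedron_halfspace_le)
  finally show ?thesis
    using assms polytope_eq_bounded_polyhedron by blast
qed

lemma strict_inequalities_interior:
  fixes w :: "'i::finite \<Rightarrow> 'a::euclidean_space"
  assumes "\<And>x. w x \<bullet> z < b x"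
  shows "z \<in> interior {y. \<forall>x. w x \<bullet> y \<le> b x}"
proof -
  have "open (\<Inter>x. {y. w x \<bullet> y < b x})"
    by (rule open_INT) (auto simp: open_halfspace_lt)
  moreover have "(\<Inter>x. {y. w x \<bullet> y < b x}) \<subseteq> {y. \<forall>x. w x \<bullet> y \<le> b x}"
    by (auto simp: less_imp_le)
  ultimately have "(\<Inter>x. {y. w x \<bullet> y < b x}) \<subseteq> interior {y. \<forall>x. w x \<bullet> y \<le> b x}"
    by (rule interior_maximal[rotated])
  then show ?thesis
    using assms by auto
qed

text \<open>The vertices make each of the inequalities define a facet, since a facet containing \<open>F x\<close> has
  the form \<open>F x'\<close>, and a vertex on \<open>F x\<close> but not on \<open>F x'\<close> exists unless \<open>x = x'\<close>.\<close>

lemma cubical_inequalities: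
  fixes w :: "'i::finite \<times> bool \<Rightarrow> 'a::euclidean_space" and b :: "'i \<times> bool \<Rightarrow> real"
  defines "P \<equiv> {y. \<forall>x. w x \<bullet> y \<le> b x}"
  defines "F \<equiv> \<lambda>x. P \<inter> {y. w x \<bullet> y = b x}"
  assumes bounded: "bounded P" and strict: "\<And>x. w x \<bullet> z < b x"
    and disj: "\<And>i. F (i, True) \<inter> F (i, False) = {}"
    and vert: "\<And>\<sigma>. \<exists>y. \<forall>i. y \<in> F (i, \<sigma> i)"
  shows "cubical UNIV P F"
proof -
  have P: "polytope P"
    using bounded unfolding P_def by (rule polytope_inequalities)
  have face: "F x face_of P" for x
    unfolding F_def
  proof (rule face_of_Int_supporting_hyperplane_le)
    show "convex P"
      using P by (rule polytope_imp_convex)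
    show "w x \<bullet> y \<le> b x" if "y \<in> P" for y
      using that unfolding P_def by blast
  qed
  have "z \<in> P"
    unfolding P_def using strict by (blast intro: less_imp_le)
  moreover have "z \<notin> F x" for x
    using strict[of x] by (simp add: F_def)
  ultimately have ne: "F x \<noteq> P" for x
    by blast
  have disj': "F (i, e) \<inter> F (i, \<not> e) = {}" for i e
    using disj[of i] by (cases e) auto
  have subset: "x = x'" if sub: "F x \<subseteq> F x'" for x x'
  proof (rule ccontr)
    obtain i e j d where ie: "x = (i, e)" "x' = (j, d)"
      by (cases x, cases x')
    assume "x \<noteq> x'"
    then have cases: "i = j \<longrightarrow> d = (\<not> e)"
      using ie by (cases e; cases d) auto
    obtain y where y: "\<And>k. y \<in> F (k, if k = i then e else \<not> d)"
      using vert[of "\<lambda>k. if k = i then e else \<not> d"] by blast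
    then have "y \<in> F (i, e)"
      using y[of i] by simp
    then have "y \<in> F (j, d)"
      using sub ie by blast
    moreover have "y \<in> F (j, \<not> d)"
      using y[of j] cases by (cases "j = i") auto
    ultimately show False
      using disj'[of j d] by blast
  qed
  have facetF: "\<exists>x. G = F x" if G: "G facet_of P" for G
  proof -
    have Gf: "G face_of P" "G \<noteq> {}" "G \<noteq> P"
      using G by (auto simp: facet_of_def)
    obtain y where y: "y \<in> rel_interior G"
      using rel_interior_eq_empty[OF face_of_imp_convex[OF Gf(1)]] Gf(2) by blast
    then have yP: "y \<in> P" "y \<in> G"
      using rel_interior_subset face_of_imp_subset[OF Gf(1)] by blast+
    have "\<exists>x. w x \<bullet> y = b x"
    proof (rule ccontr)
      assume "\<nexists>x. w x \<bullet> y = b x"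
      then have "w x \<bullet> y < b x" for x
        using yP(1) unfolding P_def by (metis (mono_tags) mem_Collect_eq order_less_le)
      then have "y \<in> rel_interior P"
        using strict_inequalities_interior[of w y b] interior_subset_rel_interior[of P]
        unfolding P_def by blast
      then show False
        using face_of_disjoint_rel_interior[OF Gf(1,3)] yP(2) by blast
    qed
    then obtain x where "y \<in> F x"
      using yP(1) by (auto simp: F_def)
    then have "G \<subseteq> F x"
      using subset_of_face_of[OF face face_of_imp_subset[OF Gf(1)]] y by blast
    then show ?thesis
      using facet_maximal[OF P G face _ ne] by blast
  qed
  have Ffacet: "F x facet_of P" for x
  proof -
    obtain y where "\<And>i. y \<in> F (i, snd x)"
      using vert[of "\<lambda>_. snd x"] by blast
    then have "y \<in> F (fst x, snd x)"
      by blast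
    then have "F x \<noteq> {}"
      by auto
    then obtain G where G: "G facet_of P" "F x \<subseteq> G"
      using face_of_polyhedron_subset_facet[OF polytope_imp_polyhedron[OF P] face _ ne] by metis
    then show ?thesis
      using facetF subset by metis
  qed
  have "facets P = F ` (UNIV \<times> UNIV)"
    unfolding facets_def UNIV_Times_UNIV using Ffacet facetF by blast
  moreover have "P \<inter> (\<Inter>i\<in>UNIV. F (i, \<sigma> i)) \<noteq> {}" for \<sigma>
  proof -
    obtain y where "\<And>i. y \<in> F (i, \<sigma> i)"
      using vert[of \<sigma>] by blast
    then have "y \<in> P \<inter> (\<Inter>i\<in>UNIV. F (i, \<sigma> i))"
      by (auto simp: F_def)
    then show ?thesis
      by blast
  qed
  ultimately show ?thesis
    using P disj by (simp add: cubical_def)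
qed

lemma cubical_unit_cube:
  "\<exists>F :: 'n \<times> bool \<Rightarrow> _. cubical UNIV (unit_cube :: (real ^ 'n) set) F"
proof -
  define w :: "'n \<times> bool \<Rightarrow> real ^ 'n" where
    "w = (\<lambda>(i, e). if e then axis i 1 else - axis i 1)"
  define b :: "'n \<times> bool \<Rightarrow> real" where "b = (\<lambda>(i, e). if e then 1 else 0)"
  have w: "w (i, True) \<bullet> y = y $ i" "w (i, False) \<bullet> y = - (y $ i)" for i y
    by (simp_all add: w_def inner_axis' )
  have b: "b (i, True) = 1" "b (i, False) = 0" for i
    by (simp_all add: b_def)
  have all: "(\<forall>x. w x \<bullet> y \<le> b x) \<longleftrightarrow> (\<forall>i. 0 \<le> y $ i \<and> y $ i \<le> 1)" for y
    unfolding split_paired_All all_bool_eq w b by auto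
  have cube: "unit_cube = {y. \<forall>x. w x \<bullet> y \<le> b x}"
    unfolding all by (auto simp: unit_cube_def mem_box_cart)
  let ?P = "{y. \<forall>x. w x \<bullet> y \<le> b x}"
  have "cubical UNIV ?P (\<lambda>x. ?P \<inter> {y. w x \<bullet> y = b x})"
  proof (rule cubical_inequalities)
    show "bounded {y. \<forall>x. w x \<bullet> y \<le> b x}"
      unfolding cube[symmetric] by (simp add: unit_cube_def)
    show "w x \<bullet> (\<chi> i. 1 / 2) < b x" for x
      by (cases x; cases "snd x") (auto simp: w b)
    show "\<exists>y. \<forall>i. y \<in> {y. \<forall>x. w x \<bullet> y \<le> b x} \<inter> {y. w (i, \<sigma> i) \<bullet> y = b (i, \<sigma> i)}" for \<sigma>
    proof -
      have "w (i, \<sigma> i) \<bullet> (\<chi> i. of_bool (\<sigma> i)) = b (i, \<sigma> i)" for i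
        by (cases "\<sigma> i") (simp_all add: w b)
      then show ?thesis
        unfolding all by (intro exI[of _ "\<chi> i. of_bool (\<sigma> i)"]) simp
    qed
  qed (auto simp: w b)
  then show ?thesis
    unfolding cube by blast
qed

text \<open>For facets with equations \<open>w x \<bullet> y = 1\<close>, the line through the origin directed by \<open>v\<close> crosses
  facet \<open>x\<close> at the inverse of \<open>w x \<bullet> v\<close>. So its line shelling lists the facets by decreasing height
  of the normals \<open>w x\<close>, the vertices of the polar polytope, in direction \<open>v\<close>.\<close>

lemma line_shelling_of_heights:
  fixes w :: "'i \<times> bool \<Rightarrow> 'a::euclidean_space" and P :: "'a set"
  defines "F \<equiv> \<lambda>x. P \<inter> {y. w x \<bullet> y = 1}"
  assumes C: "cubical UNIV P F" and int: "0 \<in> interior P"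
    and xs: "distinct xs" "set xs = UNIV"
    and nz: "\<And>x. w x \<bullet> v \<noteq> 0"
    and decr: "\<And>m n. m < n \<Longrightarrow> n < length xs \<Longrightarrow> w (xs ! n) \<bullet> v < w (xs ! m) \<bullet> v"
  shows "line_shelling P 0 v (map F xs)"
proof -
  have facet: "F x facet_of P" for x
    using cubical_facet[OF C, of "fst x" "snd x"] by simp
  have "aff_dim P = DIM('a)"
    using int by (intro aff_dim_nonempty_interior) auto
  then have dim: "aff_dim (F x) = DIM('a) - 1" "F x \<noteq> {}" for x
    using facet[of x] by (auto simp: facet_of_def)
  have hull: "affine hull F x = {y. w x \<bullet> y = 1}" for x
  proof (rule affine_dim_equal)
    have "w x \<noteq> 0"
      using nz[of x] by auto
    then show "aff_dim (affine hull F x) = aff_dim {y. w x \<bullet> y = 1}"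
      using dim(1)[of x] by (simp add: aff_dim_hyperplane)
    show "affine hull F x \<subseteq> {y. w x \<bullet> y = 1}"
      by (rule hull_minimal) (auto simp: F_def affine_hyperplane)
    show "affine hull F x \<noteq> {}"
      using dim(2)[of x] by simp
  qed (simp_all add: affine_hyperplane)
  have cross: "0 + t *\<^sub>R v \<in> affine hull F x \<longleftrightarrow> t = 1 / (w x \<bullet> v)" for t x
    using nz[of x] by (simp add: hull field_simps)
  have time: "crossing_time 0 v (F x) = 1 / (w x \<bullet> v)" for x
    unfolding crossing_time_def cross by simp
  have facets: "facets P = range F"
    using cubical_facets[OF C] by simp
  have inj: "inj (\<lambda>x. w x \<bullet> v)"
  proof (rule injI)
    fix x y assume eq: "w x \<bullet> v = w y \<bullet> v"
    obtain m n where "m < length xs" "x = xs ! m" "n < length xs" "y = xs ! n"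
      using xs(2) by (metis UNIV_I in_set_conv_nth)
    then show "x = y"
      using decr[of m n] decr[of n m] eq by (cases m n rule: linorder_cases) auto
  qed
  have "general_position P 0 v"
    unfolding general_position_def facets
  proof
    show "\<forall>G\<in>range F. \<exists>!t. 0 + t *\<^sub>R v \<in> affine hull G"
      unfolding ball_simps cross by simp
    show "inj_on (crossing_time 0 v) (range F)"
    proof (rule inj_onI)
      fix G H assume "G \<in> range F" "H \<in> range F" and eq: "crossing_time 0 v G = crossing_time 0 v H"
      then obtain x y where xy: "G = F x" "H = F y"
        by blast
      then have "w x \<bullet> v = w y \<bullet> v"
        using eq by (simp add: time)
      then show "G = H"
        using injD[OF inj] xy by blast
    qed
  qed
  moreover have "sorted_wrt (\<lambda>G H. crossed_before (crossing_time 0 v G) (crossing_time 0 v H)) (map F xs)"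
    unfolding sorted_wrt_iff_nth_less
  proof (intro allI impI)
    fix m n assume mn: "m < n" "n < length (map F xs)"
    have before: "crossed_before (1 / s) (1 / t)" if "t < s" "s \<noteq> 0" "t \<noteq> 0" for s t :: real
      using that unfolding crossed_before_def
      by (cases "0 < s"; cases "0 < t") (auto simp: field_simps)
    show "crossed_before (crossing_time 0 v (map F xs ! m)) (crossing_time 0 v (map F xs ! n))"
      using mn decr[of m n] nz before by (simp add: time)
  qed
  ultimately show ?thesis
    using int facet_ordering_map[OF C xs(1)] xs(2) by (simp add: line_shelling_def)
qed


section \<open>Realizing linked orders\<close>

lemma recursive_choice:
  fixes rank :: "'i \<Rightarrow> nat" and f :: "'i \<Rightarrow> real \<Rightarrow> real"
  assumes "\<And>i t t'. rank (m i) < rank i \<or> f i t = f i t'"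
  shows "\<exists>z. \<forall>i. z i = f i (z (m i))"
proof -
  define z where "z = wfrec (Wellfounded.measure rank) (\<lambda>g i. f i (g (m i)))"
  have "z i = f i (z (m i))" for i
  proof -
    have "z i = f i (cut z (Wellfounded.measure rank) i (m i))"
      unfolding z_def by (subst wfrec[OF wf_measure]) simp
    also have "\<dots> = f i (z (m i))"
      using assms[of i] by (metis cut_apply in_measure)
    finally show ?thesis .
  qed
  then show ?thesis
    by blast
qed

text \<open>The polar polytope is an iterated suspension. The second vertices \<open>axis i 1\<close> of the pairs form
  a basis. The first vertex of pair \<open>i\<close> is chosen such that the segment joining the pair meets the
  interior of the suspension built so far, namely on the segment from the origin to the second
  vertex of an earlier pair \<open>m i\<close>: that point is \<open>(c i / (1 + g i)) *\<^sub>R axis (m i) 1\<close>.\<close>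

definition suspension_vertex ::
  "('n \<Rightarrow> bool) \<Rightarrow> ('n \<Rightarrow> 'n) \<Rightarrow> ('n \<Rightarrow> real) \<Rightarrow> ('n \<Rightarrow> real) \<Rightarrow> 'n \<times> bool \<Rightarrow> real ^ 'n" where
  "suspension_vertex first m c g = (\<lambda>(i, e).
     if e = first i then c i *\<^sub>R axis (m i) 1 - g i *\<^sub>R axis i 1 else axis i 1)"

text \<open>In the polar polytope the bounds of coordinate \<open>i\<close> depend only on the coordinate \<open>m i\<close> of
  smaller rank, and the lower bound stays below the upper bound \<open>1\<close>. So vertices are found by choosing
  one of the two bounds in each coordinate recursively.\<close>

lemma suspension_polar_cubical:
  fixes first :: "'n::finite \<Rightarrow> bool" and rank :: "'n \<Rightarrow> nat" and m :: "'n \<Rightarrow> 'n" and c g :: "'n \<Rightarrow> real"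
  defines "w \<equiv> suspension_vertex first m c g"
  defines "P \<equiv> {y. \<forall>x. w x \<bullet> y \<le> 1}"
  assumes g: "\<And>i. 0 < g i" and c: "\<And>i. 0 \<le> c i" "\<And>i. c i < 1 + g i"
    and rank: "\<And>i. c i = 0 \<or> rank (m i) < rank i"
  shows "cubical UNIV P (\<lambda>x. P \<inter> {y. w x \<bullet> y = 1})" "0 \<in> interior P"
proof -
  have w: "w (i, first i) \<bullet> y = c i * y $ m i - g i * y $ i" "w (i, \<not> first i) \<bullet> y = y $ i" for i y
    by (simp_all add: w_def suspension_vertex_def inner_diff_left inner_axis')
  have ex: "\<exists>i. x = (i, first i) \<or> x = (i, \<not> first i)" for x
    by (cases x; cases "snd x"; cases "first (fst x)") auto
  have all: "(\<forall>x. R x) \<longleftrightarrow> (\<forall>i. R (i, first i) \<and> R (i, \<not> first i))" for R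
    using ex by metis
  have P: "y \<in> P \<longleftrightarrow> (\<forall>i. c i * y $ m i - g i * y $ i \<le> 1 \<and> y $ i \<le> 1)" for y
    unfolding P_def mem_Collect_eq all w ..
  have lower: "\<exists>L. \<forall>y\<in>P. L \<le> y $ i" for i
  proof (induction "rank i" arbitrary: i rule: less_induct)
    case less
    have "\<exists>L. \<forall>y\<in>P. c i * L \<le> c i * y $ m i"
    proof (cases "c i = 0")
      case False
      then obtain L where "\<forall>y\<in>P. L \<le> y $ m i"
        using less rank[of i] by blast
      then show ?thesis
        using c(1)[of i] by (meson mult_left_mono)
    qed simp
    then obtain L where L: "\<And>y. y \<in> P \<Longrightarrow> c i * L \<le> c i * y $ m i"
      by blast
    have "(c i * L - 1) / g i \<le> y $ i" if "y \<in> P" for y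
    proof -
      have "c i * y $ m i - g i * y $ i \<le> 1"
        using that P by blast
      then show ?thesis
        using L[OF that] g[of i] by (simp add: divide_le_eq mult.commute)
    qed
    then show ?case
      by blast
  qed
  then obtain L where L: "\<And>i y. y \<in> P \<Longrightarrow> L i \<le> y $ i"
    by metis
  have "P \<subseteq> cbox (\<chi> i. L i) (\<chi> i. 1)"
    using L P by (auto simp: mem_box_cart)
  then have bounded: "bounded P"
    using bounded_subset bounded_cbox by blast
  define F where "F = (\<lambda>x. P \<inter> {y. w x \<bullet> y = 1})"
  have disj: "F (i, True) \<inter> F (i, False) = {}" for i
  proof -
    have "False" if y: "y \<in> F (i, first i)" "y \<in> F (i, \<not> first i)" for y
    proof -
      have "y $ m i \<le> 1" "c i * y $ m i - g i * y $ i = 1" "y $ i = 1"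
        using y P w unfolding F_def by auto
      then show False
        using mult_left_mono[OF \<open>y $ m i \<le> 1\<close> c(1)[of i]] c(2)[of i] by simp
    qed
    then show ?thesis
      by (cases "first i") auto
  qed
  have vert: "\<exists>y. \<forall>i. y \<in> F (i, \<sigma> i)" for \<sigma>
  proof -
    define f where "f i t = (if \<sigma> i = first i then (c i * t - 1) / g i else 1)" for i t
    have "rank (m i) < rank i \<or> f i t = f i t'" for i t t'
      using rank[of i] by (auto simp: f_def)
    then obtain z where z': "\<And>i. z i = f i (z (m i))"
      using recursive_choice[of rank m f] by blast
    then have z: "z i = (if \<sigma> i = first i then (c i * z (m i) - 1) / g i else 1)" for i
      unfolding f_def .
    have le: "z i \<le> 1" for i
    proof (induction "rank i" arbitrary: i rule: less_induct)
      case less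
      have "c i * z (m i) \<le> c i"
        using less[of "m i"] rank[of i] c(1)[of i] by (auto intro: mult_left_le)
      then show ?case
        using z[of i] c(2)[of i] g[of i] by (simp add: divide_le_eq)
    qed
    have le': "c i * z (m i) \<le> c i" for i
      using le[of "m i"] c(1)[of i] by (simp add: mult_left_le)
    define y where "y = (\<chi> i. z i)"
    have "y \<in> P"
      unfolding P y_def
    proof (intro allI conjI)
      fix i
      show "c i * (\<chi> i. z i) $ m i - g i * (\<chi> i. z i) $ i \<le> 1"
        using z[of i] le'[of i] c(2)[of i] g[of i] by (cases "\<sigma> i = first i") (simp_all add: field_simps)
    qed (simp add: le)
    moreover have "w (i, \<sigma> i) \<bullet> y = 1" for i
    proof (cases "\<sigma> i = first i")
      case True
      then show ?thesis
        using z[of i] g[of i] by (simp add: w y_def)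
    next
      case False
      then have "\<sigma> i = (\<not> first i)"
        by blast
      then show ?thesis
        using z[of i] by (simp add: w y_def)
    qed
    ultimately show ?thesis
      by (auto simp: F_def)
  qed
  have "cubical UNIV {y. \<forall>x. w x \<bullet> y \<le> 1} (\<lambda>x. {y. \<forall>x. w x \<bullet> y \<le> 1} \<inter> {y. w x \<bullet> y = 1})"
    by (rule cubical_inequalities[where z = 0])
      (use bounded disj vert in \<open>auto simp: P_def F_def\<close>)
  then show "cubical UNIV P (\<lambda>x. P \<inter> {y. w x \<bullet> y = 1})"
    by (simp add: P_def)
  show "0 \<in> interior P"
    unfolding P_def by (rule strict_inequalities_interior) simp
qed

text \<open>The heights are prescribed: the first label gets a positive one and the others negative ones,
  so that the origin can lie on the first pair's segment. Linkedness provides for each later pair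
  \<open>i\<close> an earlier pair \<open>j\<close> whose second vertex is lower than the first vertex of \<open>i\<close>. Hence the
  segment from the origin down to that second vertex contains a point whose height lies between
  the two heights prescribed for the pair \<open>i\<close>.\<close>

lemma linked_suspension_parameters:
  fixes xs :: "('n \<times> bool) list"
  assumes L: "linked xs" and xs: "distinct xs" "set xs = UNIV"
  obtains u :: "'n \<times> bool \<Rightarrow> real" and first :: "'n \<Rightarrow> bool" and m c g and rank :: "'n \<Rightarrow> nat" where
    "\<And>x. u x \<noteq> 0"
    "\<And>k n. k < n \<Longrightarrow> n < length xs \<Longrightarrow> u (xs ! n) < u (xs ! k)"
    "\<And>i. 0 < g i" "\<And>i. 0 \<le> c i" "\<And>i. c i < 1 + g i" "\<And>i. c i = 0 \<or> rank (m i) < rank i"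
    "\<And>i. u (i, first i) = c i * u (m i, \<not> first (m i)) - g i * u (i, \<not> first i)"
proof -
  have "\<forall>x. \<exists>k. k < length xs \<and> xs ! k = x"
    using xs(2) by (metis UNIV_I in_set_conv_nth)
  then obtain pos where pos: "\<And>x. pos x < length xs" "\<And>x. xs ! pos x = x"
    by metis
  have pos_nth: "pos (xs ! k) = k" if "k < length xs" for k
    using nth_eq_iff_index_eq[OF xs(1) pos(1)[of "xs ! k"] that] pos(2)[of "xs ! k"] by simp
  have pos_inj: "pos x = pos y \<longleftrightarrow> x = y" for x y
    using pos(2) by metis
  have in_take: "x \<in> set (take k xs) \<longleftrightarrow> pos x < k" if "k < length xs" for x k
  proof
    assume "x \<in> set (take k xs)"
    then obtain l where "l < k" "x = xs ! l"
      using that by (auto simp: in_set_conv_nth)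
    then show "pos x < k"
      using pos_nth[of l] that by simp
  next
    assume "pos x < k"
    then show "x \<in> set (take k xs)"
      using pos(2)[of x] that by (auto simp: in_set_conv_nth intro!: exI[of _ "pos x"])
  qed
  define u :: "'n \<times> bool \<Rightarrow> real" where "u x = (if pos x = 0 then 1 else - real (pos x))" for x
  define first where "first i = (pos (i, True) < pos (i, False))" for i
  have first: "pos (i, first i) < pos (i, \<not> first i)" for i
  proof -
    have "pos (i, True) \<noteq> pos (i, False)"
      by (simp add: pos_inj)
    then show ?thesis
      by (cases "first i") (auto simp: first_def)
  qed
  have u2: "u (i, \<not> first i) = - real (pos (i, \<not> first i))" for i
    using first[of i] by (simp add: u_def)
  have "\<exists>m c g. 0 < g \<and> 0 \<le> c \<and> c < 1 + g \<and> (c = 0 \<or> pos (m, first m) < pos (i, first i)) \<and>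
      u (i, first i) = c * u (m, \<not> first m) - g * u (i, \<not> first i)" for i
  proof (cases "pos (i, first i) = 0")
    case True
    let ?g = "1 / real (pos (i, \<not> first i))"
    have "0 < ?g \<and> (0::real) \<le> 0 \<and> 0 < 1 + ?g \<and>
        (0 = (0::real) \<or> pos (i, first i) < pos (i, first i)) \<and>
        u (i, first i) = 0 * u (i, \<not> first i) - ?g * u (i, \<not> first i)"
      using first[of i] True unfolding u2 by (simp add: u_def add_pos_pos)
    then show ?thesis
      by blast
  next
    case False
    let ?k = "pos (i, first i)"
    obtain j e where j: "pos (j, e) < ?k" "\<not> pos (j, \<not> e) < ?k"
      using linkedD[OF L, of ?k] False pos(1) in_take by (metis gr0I)
    have "pos (j, \<not> e) \<noteq> ?k"
    proof
      assume "pos (j, \<not> e) = ?k"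
      then have "j = i" "\<not> e \<longleftrightarrow> first i"
        by (simp_all only: pos_inj prod.inject)
      then have "(j, e) = (i, \<not> first i)"
        by auto
      then show False
        using j(1) first[of i] by simp
    qed
    then have j2: "?k < pos (j, \<not> e)"
      using j(2) by simp
    have e: "e = first j"
      using j first[of j] by (cases "e = first j") auto
    \<comment> \<open>The segment of the pair \<open>i\<close> crosses that of the origin and the second vertex of \<open>j\<close> at height \<open>h\<close>.
      Positions are integers, so \<open>1 / 2\<close> below the first vertex of \<open>i\<close> is above both second vertices.\<close>
    define h lo \<mu> where "h = - real ?k - 1 / 2" and "lo = - real (pos (i, \<not> first i))"
      and "\<mu> = - real (pos (j, \<not> first j))"
    define g where "g = 1 / 2 / (h - lo)"
    have "real ?k + 1 \<le> real (pos (i, \<not> first i))" "real ?k + 1 \<le> real (pos (j, \<not> first j))"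
      using first[of i] j2 unfolding e by linarith+
    then have h: "lo < h" "\<mu> < h" "h < 0"
      by (simp_all add: h_def lo_def \<mu>_def)
    have g: "0 < g"
      using h by (simp add: g_def)
    have q: "0 \<le> h / \<mu>" "h / \<mu> < 1"
      using h by (simp_all add: divide_nonpos_nonpos divide_less_eq)
    have "g * (h - lo) = 1 / 2"
      using h by (simp add: g_def)
    then have "h + g * (h - lo) = - real ?k"
      by (simp add: h_def)
    then have "u (i, first i) = (1 + g) * (h / \<mu>) * u (j, \<not> first j) - g * u (i, \<not> first i)"
      using h False by (simp add: u2 u_def[of "(i, first i)"] flip: lo_def \<mu>_def)
        (simp add: algebra_simps)
    moreover have "(1 + g) * (h / \<mu>) < 1 + g"
      using g mult_strict_left_mono[OF q(2), of "1 + g"] by simp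
    moreover have "0 \<le> (1 + g) * (h / \<mu>)"
      using g q(1) by (intro mult_nonneg_nonneg) auto
    ultimately show ?thesis
      using g j(1) e
      by - (rule exI[of _ j], rule exI[of _ "(1 + g) * (h / \<mu>)"], rule exI[of _ g], simp)
  qed
  then obtain m c g where par:
    "\<And>i. 0 < g i \<and> 0 \<le> c i \<and> c i < 1 + g i \<and> (c i = 0 \<or> pos (m i, first (m i)) < pos (i, first i)) \<and>
      u (i, first i) = c i * u (m i, \<not> first (m i)) - g i * u (i, \<not> first i)"
    by metis
  show ?thesis
  proof (rule that[of u g c "\<lambda>i. pos (i, first i)" m first])
    show "u x \<noteq> 0" for x
      by (simp add: u_def)
    show "u (xs ! n) < u (xs ! k)" if "k < n" "n < length xs" for k n
      using that by (simp add: u_def pos_nth)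
  qed (use par in blast)+
qed

lemma linked_line_shelling:
  fixes xs :: "('n::finite \<times> bool) list"
  assumes L: "linked xs" and xs: "distinct xs" "set xs = UNIV"
  obtains Q :: "(real ^ 'n) set" and F p v where "cubical UNIV Q F" "line_shelling Q p v (map F xs)"
proof -
  obtain u :: "'n \<times> bool \<Rightarrow> real" and first :: "'n \<Rightarrow> bool" and m c g and rank :: "'n \<Rightarrow> nat" where
    u: "\<And>x. u x \<noteq> 0" "\<And>k n. k < n \<Longrightarrow> n < length xs \<Longrightarrow> u (xs ! n) < u (xs ! k)"
    and g: "\<And>i. 0 < g i" and c: "\<And>i. 0 \<le> c i" "\<And>i. c i < 1 + g i"
    and rank: "\<And>i. c i = 0 \<or> rank (m i) < rank i"
    and ux: "\<And>i. u (i, first i) = c i * u (m i, \<not> first (m i)) - g i * u (i, \<not> first i)"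
    by (rule linked_suspension_parameters[OF L xs]) blast
  define w where "w = suspension_vertex first m c g"
  define v :: "real ^ 'n" where "v = (\<chi> i. u (i, \<not> first i))"
  define Q where "Q = {y. \<forall>x. w x \<bullet> y \<le> 1}"
  define F where "F = (\<lambda>x. Q \<inter> {y. w x \<bullet> y = 1})"
  have wv: "w x \<bullet> v = u x" for x
  proof -
    obtain i e where x: "x = (i, e)"
      by (cases x)
    show ?thesis
    proof (cases "e = first i")
      case True
      then show ?thesis
        using ux[of i]
        by (simp add: x w_def suspension_vertex_def v_def inner_diff_left inner_axis')
    next
      case False
      then have "e = (\<not> first i)"
        by blast
      then show ?thesis
        by (simp add: x w_def suspension_vertex_def v_def inner_axis')
    qed
  qed
  have C: "cubical UNIV Q F" "0 \<in> interior Q"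
    using suspension_polar_cubical[where first = first and m = m and c = c and g = g and rank = rank]
      g c rank unfolding Q_def F_def w_def by blast+
  have "line_shelling Q 0 v (map F xs)"
    unfolding F_def
    by (rule line_shelling_of_heights) (use C xs u wv in \<open>simp_all add: F_def\<close>)
  with C(1) show ?thesis
    by (rule that)
qed


section \<open>Shellings of the cube and line shellings\<close>

theorem mainTheorem3:
  fixes Fs :: "(real ^ 'n) set list"
  assumes "facet_ordering (unit_cube :: (real ^ 'n) set) Fs"
  shows "shelling (unit_cube :: (real ^ 'n) set) Fs \<longleftrightarrow>
    (\<exists>(Q :: (real ^ 'n) set) \<phi> p v.
       cube_realization Q \<phi> \<and> line_shelling Q p v (map \<phi> Fs))"
proof -
  obtain F where C: "cubical (UNIV :: 'n set) (unit_cube :: (real ^ 'n) set) F"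
    using cubical_unit_cube by blast
  obtain xs where "Fs = map F xs" "distinct xs" "set xs = UNIV \<times> UNIV"
    using facet_ordering_labels[OF C assms] .
  then have xs: "Fs = map F xs" "distinct xs" "set xs = UNIV"
    by simp_all
  have "shelling unit_cube Fs \<longleftrightarrow> linked xs"
    using cubical_shelling_iff_linked[OF _ _ C xs(2)] xs(1,3) by simp
  also have "\<dots> \<longleftrightarrow> (\<exists>(Q :: (real ^ 'n) set) \<phi> p v.
       cube_realization Q \<phi> \<and> line_shelling Q p v (map \<phi> Fs))"
  proof
    assume "linked xs"
    then obtain Q :: "(real ^ 'n) set" and H p v
      where Q: "cubical UNIV Q H" "line_shelling Q p v (map H xs)"
      by (rule linked_line_shelling[OF _ xs(2,3)])
    obtain \<phi> where \<phi>: "face_lattice_iso unit_cube Q \<phi>" "\<And>x. \<phi> (F x) = H x"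
      by (rule cubical_face_lattice_iso[OF C Q(1)]) auto
    have "map \<phi> Fs = map H xs"
      using \<phi>(2) by (simp add: xs(1))
    then show "\<exists>(Q :: (real ^ 'n) set) \<phi> p v.
        cube_realization Q \<phi> \<and> line_shelling Q p v (map \<phi> Fs)"
      using \<phi>(1) Q cubical_polytope[OF Q(1)] unfolding cube_realization_def by metis
  next
    assume "\<exists>(Q :: (real ^ 'n) set) \<phi> p v.
        cube_realization Q \<phi> \<and> line_shelling Q p v (map \<phi> Fs)"
    then obtain Q :: "(real ^ 'n) set" and \<phi> p v
      where Q: "polytope Q" "face_lattice_iso unit_cube Q \<phi>" "line_shelling Q p v (map \<phi> Fs)"
      by (auto simp: cube_realization_def)
    have "cubical UNIV Q (\<lambda>x. \<phi> (F x))"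
      by (rule face_lattice_iso_cubical[OF C _ Q(1,2)]) simp
    moreover have "line_shelling Q p v (map (\<lambda>x. \<phi> (F x)) xs)"
      using Q(3) by (simp add: xs(1) comp_def)
    ultimately show "linked xs"
      by (rule line_shelling_linked[OF _ _ xs(2,3)])
  qed
  finally show ?thesis .
qed

end
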